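(* Let $(C,\Delta_0,\alpha,R)$ be a Hom-coassociative Rota-Baxter coalgebra of weight $\lambda\in\mathbb{F}$. Set $$\Delta_{-1}=(I\otimes R)\circ\Delta_0,\qquad \Delta_1=(R\otimes I)\circ\Delta_0,\qquad \bar\Delta_0=\lambda\Delta_0 .$$ Then $(C,\Delta_{-1},\bar\Delta_0,\Delta_1,\alpha)$ is a Hom-tridendriform coalgebra.
   Context: All vector spaces are over a field $\mathbb{F}$ of characteristic $0$; $I$ is the identity map. A Hom-coassociative coalgebra $(C,\Delta,\alpha)$ is a vector space $C$ with linear maps $\Delta:C\to C\otimes C$ and $\alpha:C\to C$ such that $(\alpha\otimes\Delta)\circ\Delta=(\Delta\otimes\alpha)\circ\Delta$. A Hom-coassociative Rota-Baxter coalgebra $(C,\Delta,\alpha,R)$ of weight $\lambda\in\mathbb{F}$ is a Hom-coassociative coalgebra $(C,\Delta,\alpha)$ with a linear map $R:C\to C$ such that $R\circ\alpha=\alpha\circ R$ and $(R\otimes R)\circ\Delta=\big((R\otimes I)\circ\Delta+(I\otimes R)\circ\Delta+\lambda\Delta\big)\circ R$. A Hom-tridendriform coalgebra $(C,\Delta_{-1},\Delta_0,\Delta_1,\alpha)$ is a vector space $C$ with linear maps $\Delta_{-1},\Delta_0,\Delta_1:C\to C\otimes C$ and a linear map $\alpha:C\to C$ such that (1) $(\Delta_{-1}\otimes\alpha)\circ\Delta_{-1}=(\alpha\otimes\Delta_{-1}+\alpha\otimes\Delta_1+\alpha\otimes\Delta_0)\circ\Delta_{-1}$; (2) $(\Delta_1\otimes\alpha)\circ\Delta_{-1}=(\alpha\otimes\Delta_{-1})\circ\Delta_1$;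 (3) $(\alpha\otimes\Delta_1)\circ\Delta_1=(\Delta_{-1}\otimes\alpha+\Delta_1\otimes\alpha+\Delta_0\otimes\alpha)\circ\Delta_1$; (4) $(\Delta_{-1}\otimes\alpha)\circ\Delta_0=(\alpha\otimes\Delta_1)\circ\Delta_0$; (5) $(\Delta_1\otimes\alpha)\circ\Delta_0=(\alpha\otimes\Delta_0)\circ\Delta_1$; (6) $(\Delta_0\otimes\alpha)\circ\Delta_{-1}=(\alpha\otimes\Delta_{-1})\circ\Delta_0$; (7) $(\Delta_0\otimes\alpha)\circ\Delta_0=(\alpha\otimes\Delta_0)\circ\Delta_0$. *)

theory Defs
  imports "HOL-Algebra.AbelCoset" "Jordan_Normal_Form.Missing_VectorSpace"
begin

section \<open>Tensor products of vector spaces\<close>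

text \<open>
  Vector spaces are \<^locale>\<open>vectorspace\<close>s with explicit carriers. The tensor product \<open>V \<otimes> W\<close> is
  the free vector space on the set \<open>V \<times> W\<close> modulo the subspace generated by the bilinearity
  relations, so its elements are cosets of finitely supported functions.
\<close>

definition free_space :: "('k, 'r) ring_scheme \<Rightarrow> 'x set \<Rightarrow> ('k, 'x \<Rightarrow> 'k) module" where
  "free_space K X = (LinearCombinations.ring.func_space K X)
     \<lparr>carrier := {f \<in> X \<rightarrow>\<^sub>E carrier K. finite {x \<in> X. f x \<noteq> \<zero>\<^bsub>K\<^esub>}}\<rparr>"

definition free_gen :: "('k, 'r) ring_scheme \<Rightarrow> 'x set \<Rightarrow> 'x \<Rightarrow> 'x \<Rightarrow> 'k" where
  "free_gen K X x = (\<lambda>y\<in>X. if y = x then \<one>\<^bsub>K\<^esub> else \<zero>\<^bsub>K\<^esub>)"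

text \<open>The fields \<^const>\<open>mult\<close> and \<^const>\<open>one\<close> of a module record are irrelevant here.\<close>

definition quotient_space ::
    "('k, 'v, 'm) module_scheme \<Rightarrow> 'v set \<Rightarrow> ('k, 'v set) module" where
  "quotient_space V N = \<lparr>carrier = a_rcosets\<^bsub>V\<^esub> N, mult = (\<lambda>_ _. N), one = N,
     zero = N, add = set_add V, smult = (\<lambda>c X. \<Union>x\<in>X. N +>\<^bsub>V\<^esub> (c \<odot>\<^bsub>V\<^esub> x))\<rparr>"

definition tensor_relations ::
    "('k, 'r) ring_scheme \<Rightarrow> ('k, 'v, 'm) module_scheme \<Rightarrow> ('k, 'w, 'n) module_scheme \<Rightarrow>
     ('v \<times> 'w \<Rightarrow> 'k) set" where
  "tensor_relations K V W =
    (let X = carrier V \<times> carrier W; F = free_space K X; e = (\<lambda>v w. free_gen K X (v, w)) in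
      {e (v \<oplus>\<^bsub>V\<^esub> v') w \<ominus>\<^bsub>F\<^esub> (e v w \<oplus>\<^bsub>F\<^esub> e v' w) | v v' w.
         v \<in> carrier V \<and> v' \<in> carrier V \<and> w \<in> carrier W}
    \<union> {e v (w \<oplus>\<^bsub>W\<^esub> w') \<ominus>\<^bsub>F\<^esub> (e v w \<oplus>\<^bsub>F\<^esub> e v w') | v w w'.
         v \<in> carrier V \<and> w \<in> carrier W \<and> w' \<in> carrier W}
    \<union> {e (c \<odot>\<^bsub>V\<^esub> v) w \<ominus>\<^bsub>F\<^esub> (c \<odot>\<^bsub>F\<^esub> e v w) | c v w.
         c \<in> carrier K \<and> v \<in> carrier V \<and> w \<in> carrier W}
    \<union> {e v (c \<odot>\<^bsub>W\<^esub> w) \<ominus>\<^bsub>F\<^esub> (c \<odot>\<^bsub>F\<^esub> e v w) | c v w.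
         c \<in> carrier K \<and> v \<in> carrier V \<and> w \<in> carrier W})"

definition tensor_null ::
    "('k, 'r) ring_scheme \<Rightarrow> ('k, 'v, 'm) module_scheme \<Rightarrow> ('k, 'w, 'n) module_scheme \<Rightarrow>
     ('v \<times> 'w \<Rightarrow> 'k) set" where
  "tensor_null K V W = LinearCombinations.module.span K
     (free_space K (carrier V \<times> carrier W)) (tensor_relations K V W)"

definition tensor_space ::
    "('k, 'r) ring_scheme \<Rightarrow> ('k, 'v, 'm) module_scheme \<Rightarrow> ('k, 'w, 'n) module_scheme \<Rightarrow>
     ('k, ('v \<times> 'w \<Rightarrow> 'k) set) module" where
  "tensor_space K V W =
     quotient_space (free_space K (carrier V \<times> carrier W)) (tensor_null K V W)"

definition tensor ::
    "('k, 'r) ring_scheme \<Rightarrow> ('k, 'v, 'm) module_scheme \<Rightarrow> ('k, 'w, 'n) module_scheme \<Rightarrow>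
     'v \<Rightarrow> 'w \<Rightarrow> ('v \<times> 'w \<Rightarrow> 'k) set" where
  "tensor K V W v w = tensor_null K V W
     +>\<^bsub>free_space K (carrier V \<times> carrier W)\<^esub> free_gen K (carrier V \<times> carrier W) (v, w)"

definition bilinear_map ::
    "('k, 'r) ring_scheme \<Rightarrow> ('k, 'v, 'm) module_scheme \<Rightarrow> ('k, 'w, 'n) module_scheme \<Rightarrow>
     ('k, 'u, 'l) module_scheme \<Rightarrow> ('v \<Rightarrow> 'w \<Rightarrow> 'u) \<Rightarrow> bool" where
  "bilinear_map K V W U \<beta> \<longleftrightarrow>
     (\<forall>w\<in>carrier W. (\<lambda>v. \<beta> v w) \<in> module_hom K V U) \<and>
     (\<forall>v\<in>carrier V. (\<lambda>w. \<beta> v w) \<in> module_hom K W U)"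

text \<open>
  The linear map on \<open>V \<otimes> W\<close> induced by a bilinear map \<open>\<beta>\<close>. Existence and uniqueness are shown
  in \<open>tensor_universal\<close> below.
\<close>

definition tensor_lift ::
    "('k, 'r) ring_scheme \<Rightarrow> ('k, 'v, 'm) module_scheme \<Rightarrow> ('k, 'w, 'n) module_scheme \<Rightarrow>
     ('k, 'u, 'l) module_scheme \<Rightarrow> ('v \<Rightarrow> 'w \<Rightarrow> 'u) \<Rightarrow> ('v \<times> 'w \<Rightarrow> 'k) set \<Rightarrow> 'u" where
  "tensor_lift K V W U \<beta> =
     (THE h. h \<in> module_hom K (tensor_space K V W) U \<and>
        h \<in> extensional (carrier (tensor_space K V W)) \<and>
        (\<forall>v\<in>carrier V. \<forall>w\<in>carrier W. h (tensor K V W v w) = \<beta> v w))"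

text \<open>For \<open>f : V \<rightarrow> V'\<close> and \<open>g : W \<rightarrow> W'\<close>, the map \<open>f \<otimes> g : V \<otimes> W \<rightarrow> V' \<otimes> W'\<close>.\<close>

definition tensor_map ::
    "('k, 'r) ring_scheme \<Rightarrow>
     ('k, 'v, 'm) module_scheme \<Rightarrow> ('k, 'v2, 'm2) module_scheme \<Rightarrow> ('v \<Rightarrow> 'v2) \<Rightarrow>
     ('k, 'w, 'n) module_scheme \<Rightarrow> ('k, 'w2, 'n2) module_scheme \<Rightarrow> ('w \<Rightarrow> 'w2) \<Rightarrow>
     ('v \<times> 'w \<Rightarrow> 'k) set \<Rightarrow> ('v2 \<times> 'w2 \<Rightarrow> 'k) set" where
  "tensor_map K V V' f W W' g =
     tensor_lift K V W (tensor_space K V' W') (\<lambda>v w. tensor K V' W' (f v) (g w))"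

text \<open>The canonical map \<open>(U \<otimes> V) \<otimes> W \<rightarrow> U \<otimes> (V \<otimes> W)\<close>, \<open>(u \<otimes> v) \<otimes> w \<mapsto> u \<otimes> (v \<otimes> w)\<close>.\<close>

definition tensor_assoc ::
    "('k, 'r) ring_scheme \<Rightarrow> ('k, 'u, 'l) module_scheme \<Rightarrow> ('k, 'v, 'm) module_scheme \<Rightarrow>
     ('k, 'w, 'n) module_scheme \<Rightarrow> (('u \<times> 'v \<Rightarrow> 'k) set \<times> 'w \<Rightarrow> 'k) set \<Rightarrow>
     ('u \<times> ('v \<times> 'w \<Rightarrow> 'k) set \<Rightarrow> 'k) set" where
  "tensor_assoc K U V W =
     tensor_lift K (tensor_space K U V) W (tensor_space K U (tensor_space K V W))
       (\<lambda>t w. tensor_lift K U V (tensor_space K U (tensor_space K V W))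
          (\<lambda>u v. tensor K U (tensor_space K V W) u (tensor K V W v w)) t)"


subsection \<open>The universal property\<close>

lemma free_space_sel:
  assumes "ring K"
  shows "carrier (free_space K X) = {f \<in> X \<rightarrow>\<^sub>E carrier K. finite {x \<in> X. f x \<noteq> \<zero>\<^bsub>K\<^esub>}}"
    "zero (free_space K X) = (\<lambda>x\<in>X. \<zero>\<^bsub>K\<^esub>)"
    "add (free_space K X) = (\<lambda>f g. \<lambda>x\<in>X. f x \<oplus>\<^bsub>K\<^esub> g x)"
    "smult (free_space K X) = (\<lambda>c f. \<lambda>x\<in>X. c \<otimes>\<^bsub>K\<^esub> f x)"
  by (simp_all add: free_space_def ring.func_space_def[OF assms])

lemma free_space_vectorspace:
  assumes "field K"
  shows "vectorspace K (free_space K X)"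
proof -
  interpret field K by fact
  interpret P: module K "func_space X" by (rule func_space_is_module)
  have "submodule K {f \<in> X \<rightarrow>\<^sub>E carrier K. finite {x \<in> X. f x \<noteq> \<zero>\<^bsub>K\<^esub>}} (func_space X)"
  proof (rule submodule.intro)
    fix f g
    assume f: "f \<in> {f \<in> X \<rightarrow>\<^sub>E carrier K. finite {x \<in> X. f x \<noteq> \<zero>\<^bsub>K\<^esub>}}"
      and g: "g \<in> {f \<in> X \<rightarrow>\<^sub>E carrier K. finite {x \<in> X. f x \<noteq> \<zero>\<^bsub>K\<^esub>}}"
    have "finite ({x \<in> X. f x \<noteq> \<zero>\<^bsub>K\<^esub>} \<union> {x \<in> X. g x \<noteq> \<zero>\<^bsub>K\<^esub>})"
      using f g by simp
    then have "finite {x \<in> X. (f \<oplus>\<^bsub>func_space X\<^esub> g) x \<noteq> \<zero>\<^bsub>K\<^esub>}"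
      by (rule rev_finite_subset) (use f g in \<open>auto simp: func_space_def\<close>)
    then show "f \<oplus>\<^bsub>func_space X\<^esub> g \<in>
        {f \<in> X \<rightarrow>\<^sub>E carrier K. finite {x \<in> X. f x \<noteq> \<zero>\<^bsub>K\<^esub>}}"
      using f g P.add.m_closed[of f g] by (simp add: func_space_def)
  next
    fix c f
    assume c: "c \<in> carrier K"
      and f: "f \<in> {f \<in> X \<rightarrow>\<^sub>E carrier K. finite {x \<in> X. f x \<noteq> \<zero>\<^bsub>K\<^esub>}}"
    then have "finite {x \<in> X. f x \<noteq> \<zero>\<^bsub>K\<^esub>}" by simp
    then have "finite {x \<in> X. (c \<odot>\<^bsub>func_space X\<^esub> f) x \<noteq> \<zero>\<^bsub>K\<^esub>}"
      by (rule rev_finite_subset) (use c in \<open>auto simp: func_space_def\<close>)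
    then show "c \<odot>\<^bsub>func_space X\<^esub> f \<in>
        {f \<in> X \<rightarrow>\<^sub>E carrier K. finite {x \<in> X. f x \<noteq> \<zero>\<^bsub>K\<^esub>}}"
      using c f P.smult_closed[of c f] by (simp add: func_space_def)
  qed (auto simp: func_space_def P.module_axioms[unfolded func_space_def])
  then have "module K (free_space K X)"
    unfolding free_space_def by (rule P.submodule_is_module)
  then show ?thesis
    by (intro vectorspace.intro assms)
qed

lemma free_gen_closed:
  assumes "field K" "x \<in> X"
  shows "free_gen K X x \<in> carrier (free_space K X)"
proof -
  interpret field K by fact
  have "finite {y \<in> X. free_gen K X x y \<noteq> \<zero>\<^bsub>K\<^esub>}"
    by (rule finite_subset[of _ "{x}"]) (auto simp: free_gen_def)
  then show ?thesis
    by (auto simp: free_space_sel[OF is_ring] free_gen_def)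
qed

lemma free_space_induct:
  assumes K: "field K" and f: "f \<in> carrier (free_space K X)"
    and zero: "P \<zero>\<^bsub>free_space K X\<^esub>"
    and step: "\<And>f c x. f \<in> carrier (free_space K X) \<Longrightarrow> P f \<Longrightarrow> c \<in> carrier K \<Longrightarrow> x \<in> X \<Longrightarrow>
      P (f \<oplus>\<^bsub>free_space K X\<^esub> c \<odot>\<^bsub>free_space K X\<^esub> free_gen K X x)"
  shows "P f"
  using f
proof (induction "card {x \<in> X. f x \<noteq> \<zero>\<^bsub>K\<^esub>}" arbitrary: f)
  case 0
  interpret field K by fact
  have "finite {x \<in> X. f x \<noteq> \<zero>\<^bsub>K\<^esub>}" "f \<in> X \<rightarrow>\<^sub>E carrier K"
    using 0(2) by (simp_all add: free_space_sel[OF is_ring])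
  then have "{x \<in> X. f x \<noteq> \<zero>\<^bsub>K\<^esub>} = {}" and "\<And>x. x \<notin> X \<Longrightarrow> f x = undefined"
    using 0(1) by (metis card_0_eq) (meson PiE_arb \<open>f \<in> X \<rightarrow>\<^sub>E carrier K\<close>)
  then have "f x = \<zero>\<^bsub>free_space K X\<^esub> x" for x
    by (cases "x \<in> X") (auto simp: free_space_sel[OF is_ring])
  then have "f = \<zero>\<^bsub>free_space K X\<^esub>" by blast
  then show ?case
    using zero by simp
next
  case (Suc n)
  interpret field K by fact
  have fin: "finite {x \<in> X. f x \<noteq> \<zero>\<^bsub>K\<^esub>}" and fX: "f \<in> X \<rightarrow>\<^sub>E carrier K"
    using Suc(3) by (simp_all add: free_space_sel[OF is_ring])
  obtain x where x: "x \<in> X" "f x \<noteq> \<zero>\<^bsub>K\<^esub>"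
    using Suc(2)[symmetric] by (cases "{x \<in> X. f x \<noteq> \<zero>\<^bsub>K\<^esub>} = {}") auto
  define g where "g = f(x := \<zero>\<^bsub>K\<^esub>)"
  have supp: "{y \<in> X. g y \<noteq> \<zero>\<^bsub>K\<^esub>} = {x \<in> X. f x \<noteq> \<zero>\<^bsub>K\<^esub>} - {x}"
    by (auto simp: g_def)
  have "n = card {y \<in> X. g y \<noteq> \<zero>\<^bsub>K\<^esub>}"
    using Suc(2)[symmetric] x fin by (simp add: supp)
  moreover have g: "g \<in> carrier (free_space K X)"
  proof -
    have "g \<in> X \<rightarrow>\<^sub>E carrier K"
      using fX x(1) by (auto simp: g_def PiE_iff extensional_def)
    then show ?thesis
      using fin by (simp add: free_space_sel[OF is_ring] supp)
  qed
  ultimately have "P g"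
    by (rule Suc(1))
  moreover have "f = g \<oplus>\<^bsub>free_space K X\<^esub> f x \<odot>\<^bsub>free_space K X\<^esub> free_gen K X x"
  proof
    fix y
    show "f y = (g \<oplus>\<^bsub>free_space K X\<^esub> f x \<odot>\<^bsub>free_space K X\<^esub> free_gen K X x) y"
    proof (cases "y \<in> X")
      case True
      then have "f y \<in> carrier K" "f x \<in> carrier K" using fX x by auto
      then show ?thesis
        using True x by (simp add: free_space_sel[OF is_ring] free_gen_def g_def)
    next
      case False
      then show ?thesis
        using fX by (simp add: free_space_sel[OF is_ring] PiE_arb[OF fX])
    qed
  qed
  ultimately show ?case
    using step[OF g, of "f x" x] x fX by auto
qed

lemma submodule_abelian_subgroup:
  assumes "vectorspace K V" "submodule K N V"
  shows "abelian_subgroup N V"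
proof -
  interpret vectorspace K V by fact
  interpret N: submodule K N V by fact
  have "\<ominus>\<^bsub>V\<^esub> v \<in> N" if "v \<in> N" for v
    using that N.subset by (metis R.add.inv_closed R.one_closed N.smult_closed smult_minus_1 subsetD)
  then have "subgroup N (add_monoid V)"
    using N.subset by (intro subgroup.intro) (auto simp: a_inv_def[symmetric])
  then show ?thesis
    by (intro abelian_subgroupI3 additive_subgroupI M.abelian_group_axioms)
qed

lemma quotient_space_sel [simp]:
  "carrier (quotient_space V N) = a_rcosets\<^bsub>V\<^esub> N"
  "zero (quotient_space V N) = N"
  "add (quotient_space V N) = set_add V"
  by (simp_all add: quotient_space_def)

lemma quotient_space_smult:
  assumes "vectorspace K V" "submodule K N V" "c \<in> carrier K" "v \<in> carrier V"
  shows "c \<odot>\<^bsub>quotient_space V N\<^esub> (N +>\<^bsub>V\<^esub> v) = N +>\<^bsub>V\<^esub> (c \<odot>\<^bsub>V\<^esub> v)"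
proof -
  interpret vectorspace K V by fact
  interpret N: submodule K N V by fact
  interpret A: abelian_subgroup N V by (rule submodule_abelian_subgroup) fact+
  have "N +>\<^bsub>V\<^esub> (c \<odot>\<^bsub>V\<^esub> x) = N +>\<^bsub>V\<^esub> (c \<odot>\<^bsub>V\<^esub> v)" if x: "x \<in> N +>\<^bsub>V\<^esub> v" for x
  proof -
    obtain n where n: "n \<in> N" "x = n \<oplus>\<^bsub>V\<^esub> v"
      using x by (auto simp: a_r_coset_def')
    then have "c \<odot>\<^bsub>V\<^esub> x = c \<odot>\<^bsub>V\<^esub> n \<oplus>\<^bsub>V\<^esub> c \<odot>\<^bsub>V\<^esub> v"
      using N.subset assms by (auto intro: smult_r_distr)
    then have "c \<odot>\<^bsub>V\<^esub> x \<in> N +>\<^bsub>V\<^esub> (c \<odot>\<^bsub>V\<^esub> v)"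
      using n assms by (auto simp: a_r_coset_def')
    then show ?thesis
      using assms by (metis M.a_repr_independence A.a_subgroup smult_closed)
  qed
  then have "(\<Union>x\<in>N +>\<^bsub>V\<^esub> v. N +>\<^bsub>V\<^esub> (c \<odot>\<^bsub>V\<^esub> x)) =
      (\<Union>x\<in>N +>\<^bsub>V\<^esub> v. N +>\<^bsub>V\<^esub> (c \<odot>\<^bsub>V\<^esub> v))"
    by (intro SUP_cong refl)
  moreover have "N +>\<^bsub>V\<^esub> v \<noteq> {}"
    using A.a_rcos_self[OF assms(4)] by blast
  ultimately show ?thesis
    unfolding quotient_space_def by (simp only: module.simps UN_constant if_False)
qed

lemma quotient_space_vectorspace:
  assumes "vectorspace K V" "submodule K N V"
  shows "vectorspace K (quotient_space V N)"
proof -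
  interpret vectorspace K V by fact
  interpret A: abelian_subgroup N V by (rule submodule_abelian_subgroup) fact+
  note sm = quotient_space_smult[OF assms]
  have ex: "\<exists>v\<in>carrier V. X = N +>\<^bsub>V\<^esub> v" if "X \<in> a_rcosets\<^bsub>V\<^esub> N" for X
    using that by (auto simp: A_RCOSETS_def')
  have cl: "N +>\<^bsub>V\<^esub> v \<in> a_rcosets\<^bsub>V\<^esub> N" if "v \<in> carrier V" for v
    using that by (auto simp: A_RCOSETS_def')
  have N: "N = N +>\<^bsub>V\<^esub> \<zero>\<^bsub>V\<^esub>"
    using A.a_subset by simp
  have "module K (quotient_space V N)"
  proof (rule module_criteria)
    show "\<forall>v\<in>carrier (quotient_space V N).
        \<exists>w\<in>carrier (quotient_space V N). v \<oplus>\<^bsub>quotient_space V N\<^esub> w = \<zero>\<^bsub>quotient_space V N\<^esub>"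
    proof
      fix X assume "X \<in> carrier (quotient_space V N)"
      then obtain v where v: "v \<in> carrier V" "X = N +>\<^bsub>V\<^esub> v" using ex by auto
      then show "\<exists>w\<in>carrier (quotient_space V N). X \<oplus>\<^bsub>quotient_space V N\<^esub> w = \<zero>\<^bsub>quotient_space V N\<^esub>"
        using A.a_subset by (intro bexI[of _ "N +>\<^bsub>V\<^esub> (\<ominus>\<^bsub>V\<^esub> v)"]) (auto simp: A.a_rcos_sum M.r_neg cl)
    qed
    show "cring K" by (rule is_cring)
    show "\<zero>\<^bsub>quotient_space V N\<^esub> \<in> carrier (quotient_space V N)"
      by (simp add: A.a_subgroup_in_rcosets)
    show "\<forall>X\<in>carrier (quotient_space V N).
        X \<oplus>\<^bsub>quotient_space V N\<^esub> \<zero>\<^bsub>quotient_space V N\<^esub> = X"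
    proof
      fix X assume "X \<in> carrier (quotient_space V N)"
      then obtain v where v: "v \<in> carrier V" "X = N +>\<^bsub>V\<^esub> v" using ex by auto
      then have "X <+>\<^bsub>V\<^esub> (N +>\<^bsub>V\<^esub> \<zero>\<^bsub>V\<^esub>) = X"
        by (simp add: A.a_rcos_sum del: M.a_coset_add_zero)
      then show "X \<oplus>\<^bsub>quotient_space V N\<^esub> \<zero>\<^bsub>quotient_space V N\<^esub> = X"
        using N by simp
    qed
  qed (auto dest!: ex simp: A.a_rcos_sum sm cl M.a_ac smult_l_distr smult_r_distr smult_assoc1)
  then show ?thesis
    by (intro vectorspace.intro field_axioms)
qed

lemma tensor_relations_closed:
  assumes "vectorspace K V" "vectorspace K W"
  shows "tensor_relations K V W \<subseteq> carrier (free_space K (carrier V \<times> carrier W))"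
proof -
  interpret V: vectorspace K V by fact
  interpret W: vectorspace K W by fact
  interpret F: vectorspace K "free_space K (carrier V \<times> carrier W)"
    by (rule free_space_vectorspace) (rule V.field_axioms)
  have "free_gen K (carrier V \<times> carrier W) (v, w) \<in> carrier (free_space K (carrier V \<times> carrier W))"
    if "v \<in> carrier V" "w \<in> carrier W" for v w
    using that by (intro free_gen_closed V.field_axioms) simp
  then show ?thesis
    unfolding tensor_relations_def Let_def by auto
qed

lemma tensor_null_submodule:
  assumes "vectorspace K V" "vectorspace K W"
  shows "submodule K (tensor_null K V W) (free_space K (carrier V \<times> carrier W))"
proof -
  interpret V: vectorspace K V by fact
  interpret F: vectorspace K "free_space K (carrier V \<times> carrier W)"
    by (rule free_space_vectorspace) (rule V.field_axioms)
  show ?thesis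
    unfolding tensor_null_def by (intro F.span_is_submodule tensor_relations_closed assms)
qed

lemma tensor_space_vectorspace:
  assumes "vectorspace K V" "vectorspace K W"
  shows "vectorspace K (tensor_space K V W)"
  unfolding tensor_space_def
  by (intro quotient_space_vectorspace free_space_vectorspace tensor_null_submodule assms
      vectorspace.axioms(2)[OF assms(1)])

lemma tensor_bilinear:
  assumes "vectorspace K V" "vectorspace K W"
  shows "bilinear_map K V W (tensor_space K V W) (tensor K V W)"
proof -
  interpret V: vectorspace K V by fact
  interpret W: vectorspace K W by fact
  let ?F = "free_space K (carrier V \<times> carrier W)" and ?N = "tensor_null K V W"
  let ?e = "\<lambda>v w. free_gen K (carrier V \<times> carrier W) (v, w)"
  have F: "vectorspace K ?F"
    by (rule free_space_vectorspace) (rule V.field_axioms)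
  interpret F: vectorspace K ?F by (rule F)
  have N: "submodule K ?N ?F"
    by (rule tensor_null_submodule) fact+
  interpret A: abelian_subgroup ?N ?F by (rule submodule_abelian_subgroup[OF F N])
  have e: "?e v w \<in> carrier ?F" if "v \<in> carrier V" "w \<in> carrier W" for v w
    using that by (intro free_gen_closed V.field_axioms) simp
  have rel: "tensor_relations K V W \<subseteq> ?N"
    unfolding tensor_null_def by (intro F.in_own_span tensor_relations_closed assms)
  have coset: "?N +>\<^bsub>?F\<^esub> a = ?N +>\<^bsub>?F\<^esub> b"
    if ab: "a \<in> carrier ?F" "b \<in> carrier ?F" and "a \<ominus>\<^bsub>?F\<^esub> b \<in> tensor_relations K V W" for a b
  proof -
    have "a \<ominus>\<^bsub>?F\<^esub> b \<in> ?N" using that rel by blast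
    then have "(a \<ominus>\<^bsub>?F\<^esub> b) \<oplus>\<^bsub>?F\<^esub> b \<in> ?N +>\<^bsub>?F\<^esub> b"
      by (auto simp: a_r_coset_def')
    moreover have "(a \<ominus>\<^bsub>?F\<^esub> b) \<oplus>\<^bsub>?F\<^esub> b = a"
      using ab by (simp add: a_minus_def F.M.a_assoc F.M.l_neg)
    ultimately show ?thesis
      using ab by (metis F.M.a_repr_independence A.a_subgroup)
  qed
  have cl: "tensor K V W v w \<in> carrier (tensor_space K V W)" if "v \<in> carrier V" "w \<in> carrier W" for v w
    using e[OF that] by (auto simp: tensor_def tensor_space_def A_RCOSETS_def')
  have add: "tensor K V W v w \<oplus>\<^bsub>tensor_space K V W\<^esub> tensor K V W v' w' = ?N +>\<^bsub>?F\<^esub> (?e v w \<oplus>\<^bsub>?F\<^esub> ?e v' w')"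
    if "v \<in> carrier V" "w \<in> carrier W" "v' \<in> carrier V" "w' \<in> carrier W" for v w v' w'
    using that by (simp add: tensor_def tensor_space_def A.a_rcos_sum e)
  have smult: "c \<odot>\<^bsub>tensor_space K V W\<^esub> tensor K V W v w = ?N +>\<^bsub>?F\<^esub> (c \<odot>\<^bsub>?F\<^esub> ?e v w)"
    if "c \<in> carrier K" "v \<in> carrier V" "w \<in> carrier W" for c v w
    using that unfolding tensor_def tensor_space_def by (intro quotient_space_smult[OF F N] e)
  show ?thesis
    unfolding bilinear_map_def module_hom_def
  proof (intro conjI ballI CollectI allI impI funcsetI; (elim conjE)?)
    fix v v' w assume "v \<in> carrier V" "v' \<in> carrier V" "w \<in> carrier W"
    then show "tensor K V W (v \<oplus>\<^bsub>V\<^esub> v') w = tensor K V W v w \<oplus>\<^bsub>tensor_space K V W\<^esub> tensor K V W v' w"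
      by (simp add: add) (unfold tensor_def, rule coset, auto intro!: e simp: tensor_relations_def Let_def)
  next
    fix v w w' assume "v \<in> carrier V" "w \<in> carrier W" "w' \<in> carrier W"
    then show "tensor K V W v (w \<oplus>\<^bsub>W\<^esub> w') = tensor K V W v w \<oplus>\<^bsub>tensor_space K V W\<^esub> tensor K V W v w'"
      by (simp add: add) (unfold tensor_def, rule coset, auto intro!: e simp: tensor_relations_def Let_def)
  next
    fix c v w assume "c \<in> carrier K" "v \<in> carrier V" "w \<in> carrier W"
    then show "tensor K V W (c \<odot>\<^bsub>V\<^esub> v) w = c \<odot>\<^bsub>tensor_space K V W\<^esub> tensor K V W v w"
      by (simp add: smult) (unfold tensor_def, rule coset, auto intro!: e simp: tensor_relations_def Let_def)
  next
    fix c v w assume "c \<in> carrier K" "v \<in> carrier V" "w \<in> carrier W"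
    then show "tensor K V W v (c \<odot>\<^bsub>W\<^esub> w) = c \<odot>\<^bsub>tensor_space K V W\<^esub> tensor K V W v w"
      by (simp add: smult) (unfold tensor_def, rule coset, auto intro!: e simp: tensor_relations_def Let_def)
  qed (auto intro: cl)
qed

lemma tensor_induct:
  assumes VW: "vectorspace K V" "vectorspace K W" and t: "t \<in> carrier (tensor_space K V W)"
    and zero: "P \<zero>\<^bsub>tensor_space K V W\<^esub>"
    and step: "\<And>t v w. t \<in> carrier (tensor_space K V W) \<Longrightarrow> P t \<Longrightarrow>
      v \<in> carrier V \<Longrightarrow> w \<in> carrier W \<Longrightarrow> P (t \<oplus>\<^bsub>tensor_space K V W\<^esub> tensor K V W v w)"
  shows "P t"
proof -
  interpret V: vectorspace K V by fact
  let ?F = "free_space K (carrier V \<times> carrier W)" and ?N = "tensor_null K V W"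
  have F: "vectorspace K ?F"
    by (rule free_space_vectorspace) (rule V.field_axioms)
  interpret F: vectorspace K ?F by (rule F)
  have N: "submodule K ?N ?F"
    by (rule tensor_null_submodule) fact+
  interpret A: abelian_subgroup ?N ?F by (rule submodule_abelian_subgroup[OF F N])
  obtain f where f: "f \<in> carrier ?F" "t = ?N +>\<^bsub>?F\<^esub> f"
    using t by (auto simp: tensor_space_def A_RCOSETS_def')
  have "P (?N +>\<^bsub>?F\<^esub> f)"
    using f(1)
  proof (rule free_space_induct[OF V.field_axioms])
    show "P (?N +>\<^bsub>?F\<^esub> \<zero>\<^bsub>?F\<^esub>)"
      using zero A.a_subset by (simp add: tensor_space_def)
  next
    fix g c x
    assume g: "g \<in> carrier ?F" "P (?N +>\<^bsub>?F\<^esub> g)" and c: "c \<in> carrier K"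
      and x: "x \<in> carrier V \<times> carrier W"
    obtain v w where vw: "x = (v, w)" "v \<in> carrier V" "w \<in> carrier W" using x by auto
    have e: "free_gen K (carrier V \<times> carrier W) x \<in> carrier ?F"
      using x by (intro free_gen_closed V.field_axioms)
    have "tensor K V W (c \<odot>\<^bsub>V\<^esub> v) w = c \<odot>\<^bsub>tensor_space K V W\<^esub> tensor K V W v w"
      using tensor_bilinear[OF VW] c vw
      unfolding bilinear_map_def by (auto dest: module_hom_smult)
    also have "\<dots> = ?N +>\<^bsub>?F\<^esub> (c \<odot>\<^bsub>?F\<^esub> free_gen K (carrier V \<times> carrier W) x)"
      unfolding tensor_def tensor_space_def vw(1)[symmetric]
      by (rule quotient_space_smult[OF F N c e])
    finally have "?N +>\<^bsub>?F\<^esub> (g \<oplus>\<^bsub>?F\<^esub> c \<odot>\<^bsub>?F\<^esub> free_gen K (carrier V \<times> carrier W) x)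
        = (?N +>\<^bsub>?F\<^esub> g) \<oplus>\<^bsub>tensor_space K V W\<^esub> tensor K V W (c \<odot>\<^bsub>V\<^esub> v) w"
      using g c e by (simp add: A.a_rcos_sum tensor_space_def)
    moreover have "?N +>\<^bsub>?F\<^esub> g \<in> carrier (tensor_space K V W)"
      using g by (auto simp: tensor_space_def A_RCOSETS_def')
    ultimately show "P (?N +>\<^bsub>?F\<^esub> (g \<oplus>\<^bsub>?F\<^esub> c \<odot>\<^bsub>?F\<^esub> free_gen K (carrier V \<times> carrier W) x))"
      using step[OF _ g(2)] c vw by simp
  qed
  then show ?thesis using f by simp
qed

lemma free_space_universal:
  assumes K: "field K" and U: "vectorspace K U" and \<beta>: "\<beta> \<in> X \<rightarrow> carrier U"
  obtains \<phi> where "\<phi> \<in> module_hom K (free_space K X) U"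
    "\<And>x. x \<in> X \<Longrightarrow> \<phi> (free_gen K X x) = \<beta> x"
proof -
  interpret U: vectorspace K U by fact
  note sel = free_space_sel[OF U.is_ring]
  define \<phi> where "\<phi> = (\<lambda>f. \<Oplus>\<^bsub>U\<^esub>x\<in>{x \<in> X. f x \<noteq> \<zero>\<^bsub>K\<^esub>}. f x \<odot>\<^bsub>U\<^esub> \<beta> x)"
  have \<phi>: "\<phi> f = (\<Oplus>\<^bsub>U\<^esub>x\<in>S. f x \<odot>\<^bsub>U\<^esub> \<beta> x)"
    if "f \<in> X \<rightarrow>\<^sub>E carrier K" "finite S" "S \<subseteq> X" "{x \<in> X. f x \<noteq> \<zero>\<^bsub>K\<^esub>} \<subseteq> S" for f S
    unfolding \<phi>_def
  proof (rule U.M.add.finprod_mono_neutral_cong_left)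
    fix x assume "x \<in> S - {x \<in> X. f x \<noteq> \<zero>\<^bsub>K\<^esub>}"
    then have "f x = \<zero>\<^bsub>K\<^esub>" "\<beta> x \<in> carrier U" using that \<beta> by auto
    then show "f x \<odot>\<^bsub>U\<^esub> \<beta> x = \<zero>\<^bsub>U\<^esub>" by simp
  next
    show "(\<lambda>x. f x \<odot>\<^bsub>U\<^esub> \<beta> x) \<in> S \<rightarrow> carrier U"
      using that(1,3) \<beta> by (auto intro!: U.smult_closed)
  qed (use that in auto)
  have "\<phi> \<in> module_hom K (free_space K X) U"
    unfolding module_hom_def
  proof (intro CollectI conjI allI impI funcsetI; (elim conjE)?)
    fix f assume "f \<in> carrier (free_space K X)"
    then have "f \<in> X \<rightarrow>\<^sub>E carrier K" by (simp add: sel)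
    then show "\<phi> f \<in> carrier U"
      unfolding \<phi>_def using \<beta> by (auto intro!: U.M.finsum_closed U.smult_closed)
  next
    fix f g assume fg: "f \<in> carrier (free_space K X)" "g \<in> carrier (free_space K X)"
    then have f: "f \<in> X \<rightarrow>\<^sub>E carrier K" and g: "g \<in> X \<rightarrow>\<^sub>E carrier K" by (simp_all add: sel)
    interpret F: vectorspace K "free_space K X" by (rule free_space_vectorspace) fact
    have fg': "f \<oplus>\<^bsub>free_space K X\<^esub> g \<in> X \<rightarrow>\<^sub>E carrier K"
      using F.M.add.m_closed[OF fg] by (simp add: sel)
    let ?S = "{x \<in> X. f x \<noteq> \<zero>\<^bsub>K\<^esub>} \<union> {x \<in> X. g x \<noteq> \<zero>\<^bsub>K\<^esub>}"
    have S: "finite ?S" "?S \<subseteq> X" using fg by (auto simp: sel)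
    have "\<phi> (f \<oplus>\<^bsub>free_space K X\<^esub> g) = (\<Oplus>\<^bsub>U\<^esub>x\<in>?S. (f \<oplus>\<^bsub>free_space K X\<^esub> g) x \<odot>\<^bsub>U\<^esub> \<beta> x)"
      by (rule \<phi>[OF fg' S]) (auto simp: sel)
    also have "\<dots> = (\<Oplus>\<^bsub>U\<^esub>x\<in>?S. f x \<odot>\<^bsub>U\<^esub> \<beta> x \<oplus>\<^bsub>U\<^esub> g x \<odot>\<^bsub>U\<^esub> \<beta> x)"
    proof (rule U.M.finsum_cong'[OF refl])
      show "(\<lambda>x. f x \<odot>\<^bsub>U\<^esub> \<beta> x \<oplus>\<^bsub>U\<^esub> g x \<odot>\<^bsub>U\<^esub> \<beta> x) \<in> ?S \<rightarrow> carrier U"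
        using f g \<beta> by (auto intro!: U.smult_closed U.M.add.m_closed)
    next
      fix x assume "x \<in> ?S"
      then have "x \<in> X" by auto
      then have "x \<in> X" "f x \<in> carrier K" "g x \<in> carrier K" "\<beta> x \<in> carrier U" using f g \<beta> by auto
      then show "(f \<oplus>\<^bsub>free_space K X\<^esub> g) x \<odot>\<^bsub>U\<^esub> \<beta> x = f x \<odot>\<^bsub>U\<^esub> \<beta> x \<oplus>\<^bsub>U\<^esub> g x \<odot>\<^bsub>U\<^esub> \<beta> x"
        by (simp add: sel U.smult_l_distr)
    qed
    also have "\<dots> = (\<Oplus>\<^bsub>U\<^esub>x\<in>?S. f x \<odot>\<^bsub>U\<^esub> \<beta> x) \<oplus>\<^bsub>U\<^esub> (\<Oplus>\<^bsub>U\<^esub>x\<in>?S. g x \<odot>\<^bsub>U\<^esub> \<beta> x)"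
      using f g \<beta> by (intro U.M.finsum_addf) (auto intro!: U.smult_closed)
    also have "\<dots> = \<phi> f \<oplus>\<^bsub>U\<^esub> \<phi> g"
      by (subst (1 2) \<phi>[OF _ S]) (use f g in auto)
    finally show "\<phi> (f \<oplus>\<^bsub>free_space K X\<^esub> g) = \<phi> f \<oplus>\<^bsub>U\<^esub> \<phi> g" .
  next
    fix c f assume c: "c \<in> carrier K" and fF: "f \<in> carrier (free_space K X)"
    then have f: "f \<in> X \<rightarrow>\<^sub>E carrier K" by (simp add: sel)
    interpret F: vectorspace K "free_space K X" by (rule free_space_vectorspace) fact
    have cf: "c \<odot>\<^bsub>free_space K X\<^esub> f \<in> X \<rightarrow>\<^sub>E carrier K"
      using F.smult_closed[OF c fF] by (simp add: sel)
    let ?S = "{x \<in> X. f x \<noteq> \<zero>\<^bsub>K\<^esub>}"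
    have S: "finite ?S" "?S \<subseteq> X" using fF by (auto simp: sel)
    have "\<phi> (c \<odot>\<^bsub>free_space K X\<^esub> f) = (\<Oplus>\<^bsub>U\<^esub>x\<in>?S. (c \<odot>\<^bsub>free_space K X\<^esub> f) x \<odot>\<^bsub>U\<^esub> \<beta> x)"
      by (rule \<phi>[OF cf S]) (use c in \<open>auto simp: sel\<close>)
    also have "\<dots> = (\<Oplus>\<^bsub>U\<^esub>x\<in>?S. c \<odot>\<^bsub>U\<^esub> (f x \<odot>\<^bsub>U\<^esub> \<beta> x))"
    proof (rule U.M.finsum_cong'[OF refl])
      show "(\<lambda>x. c \<odot>\<^bsub>U\<^esub> (f x \<odot>\<^bsub>U\<^esub> \<beta> x)) \<in> ?S \<rightarrow> carrier U"
        using f c \<beta> by (auto intro!: U.smult_closed)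
    next
      fix x assume "x \<in> ?S"
      then have "x \<in> X" by auto
      then have "x \<in> X" "f x \<in> carrier K" "\<beta> x \<in> carrier U" using f \<beta> by auto
      then show "(c \<odot>\<^bsub>free_space K X\<^esub> f) x \<odot>\<^bsub>U\<^esub> \<beta> x = c \<odot>\<^bsub>U\<^esub> (f x \<odot>\<^bsub>U\<^esub> \<beta> x)"
        using c by (simp add: sel U.smult_assoc1)
    qed
    also have "\<dots> = c \<odot>\<^bsub>U\<^esub> \<phi> f"
      unfolding \<phi>_def using S c f \<beta>
      by (intro U.finsum_smult_ldistr[symmetric]) (auto intro!: U.smult_closed)
    finally show "\<phi> (c \<odot>\<^bsub>free_space K X\<^esub> f) = c \<odot>\<^bsub>U\<^esub> \<phi> f" .
  qed
  moreover have "\<phi> (free_gen K X x) = \<beta> x" if x: "x \<in> X" for x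
  proof -
    have "{y \<in> X. free_gen K X x y \<noteq> \<zero>\<^bsub>K\<^esub>} = {x}"
      using x U.one_not_zero by (auto simp: free_gen_def)
    moreover have "\<beta> x \<in> carrier U" using x \<beta> by auto
    ultimately show ?thesis
      using x by (simp add: \<phi>_def free_gen_def)
  qed
  ultimately show ?thesis by (rule that)
qed

lemma module_hom_zero:
  assumes "vectorspace K V" "vectorspace K W" "h \<in> module_hom K V W"
  shows "h \<zero>\<^bsub>V\<^esub> = \<zero>\<^bsub>W\<^esub>"
  using assms
  by (intro mod_hom.f0_is_0[of K V W h] mod_hom.intro mod_hom_axioms.intro)
    (auto simp: vectorspace_def)

lemma tensor_closed:
  assumes "vectorspace K V" "vectorspace K W" "v \<in> carrier V" "w \<in> carrier W"
  shows "tensor K V W v w \<in> carrier (tensor_space K V W)"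
  using tensor_bilinear[OF assms(1,2)] assms(3,4)
  unfolding bilinear_map_def module_hom_def by (auto dest!: bspec[of _ _ w])

lemma tensor_hom_eqI:
  assumes VW: "vectorspace K V" "vectorspace K W" and U: "vectorspace K U"
    and h: "h \<in> module_hom K (tensor_space K V W) U" "h' \<in> module_hom K (tensor_space K V W) U"
    and eq: "\<And>v w. v \<in> carrier V \<Longrightarrow> w \<in> carrier W \<Longrightarrow> h (tensor K V W v w) = h' (tensor K V W v w)"
    and t: "t \<in> carrier (tensor_space K V W)"
  shows "h t = h' t"
proof -
  note T = tensor_space_vectorspace[OF VW]
  show ?thesis
    using VW t
  proof (rule tensor_induct)
    show "h \<zero>\<^bsub>tensor_space K V W\<^esub> = h' \<zero>\<^bsub>tensor_space K V W\<^esub>"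
      using h by (simp add: module_hom_zero[OF T U])
  next
    fix s v w
    assume "s \<in> carrier (tensor_space K V W)" "h s = h' s" "v \<in> carrier V" "w \<in> carrier W"
    then show "h (s \<oplus>\<^bsub>tensor_space K V W\<^esub> tensor K V W v w) = h' (s \<oplus>\<^bsub>tensor_space K V W\<^esub> tensor K V W v w)"
      by (simp add: module_hom_add[OF h(1)] module_hom_add[OF h(2)] eq tensor_closed[OF VW])
  qed
qed

theorem tensor_universal:
  assumes VW: "vectorspace K V" "vectorspace K W" and U: "vectorspace K U"
    and \<beta>: "bilinear_map K V W U \<beta>"
  shows "\<exists>!h. h \<in> module_hom K (tensor_space K V W) U \<and>
    h \<in> extensional (carrier (tensor_space K V W)) \<and>
    (\<forall>v\<in>carrier V. \<forall>w\<in>carrier W. h (tensor K V W v w) = \<beta> v w)"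
proof (rule ex_ex1I)
  interpret V: vectorspace K V by fact
  interpret W: vectorspace K W by fact
  interpret U: vectorspace K U by fact
  let ?X = "carrier V \<times> carrier W"
  let ?F = "free_space K ?X" and ?N = "tensor_null K V W" and ?T = "tensor_space K V W"
  have F: "vectorspace K ?F"
    by (rule free_space_vectorspace) (rule V.field_axioms)
  interpret F: vectorspace K ?F by (rule F)
  have N: "submodule K ?N ?F"
    by (rule tensor_null_submodule) fact+
  interpret A: abelian_subgroup ?N ?F by (rule submodule_abelian_subgroup[OF F N])
  have \<beta>1: "(\<lambda>v. \<beta> v w) \<in> module_hom K V U" if "w \<in> carrier W" for w
    using \<beta> that by (simp add: bilinear_map_def)
  have \<beta>2: "\<beta> v \<in> module_hom K W U" if "v \<in> carrier V" for v
    using \<beta> that by (simp add: bilinear_map_def)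
  have \<beta>c: "\<beta> v w \<in> carrier U" if "v \<in> carrier V" "w \<in> carrier W" for v w
    using module_hom_closed[OF \<beta>1] that by blast
  have \<beta>X: "case_prod \<beta> \<in> ?X \<rightarrow> carrier U" using \<beta>c by auto
  obtain \<phi> where \<phi>: "\<phi> \<in> module_hom K ?F U"
    and \<phi>e: "\<And>x. x \<in> ?X \<Longrightarrow> \<phi> (free_gen K ?X x) = case_prod \<beta> x"
    using free_space_universal[OF V.field_axioms U \<beta>X] by blast
  interpret \<phi>: mod_hom K ?F U \<phi>
    using \<phi> by (intro mod_hom.intro mod_hom_axioms.intro F.module_axioms U.module_axioms)
  have e: "free_gen K ?X (v, w) \<in> carrier ?F" if "v \<in> carrier V" "w \<in> carrier W" for v w
    using that by (intro free_gen_closed V.field_axioms) simp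
  have "tensor_relations K V W \<subseteq> \<phi>.ker"
    unfolding tensor_relations_def Let_def \<phi>.ker_def
    by (auto simp: e \<phi>e \<beta>c module_hom_add[OF \<beta>1] module_hom_add[OF \<beta>2]
        module_hom_smult[OF \<beta>1] module_hom_smult[OF \<beta>2])
  then have ker: "?N \<subseteq> \<phi>.ker"
    unfolding tensor_null_def by (intro F.span_is_subset \<phi>.ker_is_submodule)
  define h where "h = (\<lambda>t\<in>carrier ?T. \<phi> (SOME f. f \<in> t))"
  have h: "h (?N +>\<^bsub>?F\<^esub> f) = \<phi> f" if f: "f \<in> carrier ?F" for f
  proof -
    have const: "\<phi> g = \<phi> f" if "g \<in> ?N +>\<^bsub>?F\<^esub> f" for g
    proof -
      obtain n where n: "n \<in> ?N" "g = n \<oplus>\<^bsub>?F\<^esub> f"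
        using \<open>g \<in> _\<close> by (auto simp: a_r_coset_def')
      then have "n \<in> carrier ?F" "\<phi> n = \<zero>\<^bsub>U\<^esub>" using ker by (auto simp: \<phi>.ker_def)
      then show ?thesis using n f by simp
    qed
    have "(SOME g. g \<in> ?N +>\<^bsub>?F\<^esub> f) \<in> ?N +>\<^bsub>?F\<^esub> f"
      using A.a_rcos_self[OF f] by (auto simp: some_in_eq)
    moreover have "?N +>\<^bsub>?F\<^esub> f \<in> carrier ?T"
      using f by (auto simp: tensor_space_def A_RCOSETS_def')
    ultimately show ?thesis by (simp add: h_def const)
  qed
  have rep: "\<exists>f\<in>carrier ?F. t = ?N +>\<^bsub>?F\<^esub> f" if "t \<in> carrier ?T" for t
    using that by (auto simp: tensor_space_def A_RCOSETS_def')
  have "h \<in> module_hom K ?T U"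
    unfolding module_hom_def
  proof (intro CollectI conjI allI impI funcsetI; (elim conjE)?)
    fix t assume "t \<in> carrier ?T"
    then obtain f where "f \<in> carrier ?F" "t = ?N +>\<^bsub>?F\<^esub> f" using rep by blast
    then show "h t \<in> carrier U" by (simp add: h)
  next
    fix s t assume "s \<in> carrier ?T" "t \<in> carrier ?T"
    then obtain f g where "f \<in> carrier ?F" "s = ?N +>\<^bsub>?F\<^esub> f" "g \<in> carrier ?F" "t = ?N +>\<^bsub>?F\<^esub> g"
      using rep by meson
    then show "h (s \<oplus>\<^bsub>?T\<^esub> t) = h s \<oplus>\<^bsub>U\<^esub> h t"
      by (simp add: h tensor_space_def A.a_rcos_sum)
  next
    fix c t assume c: "c \<in> carrier K" and "t \<in> carrier ?T"
    then obtain f where f: "f \<in> carrier ?F" "t = ?N +>\<^bsub>?F\<^esub> f" using rep by blast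
    then have "c \<odot>\<^bsub>?T\<^esub> t = ?N +>\<^bsub>?F\<^esub> (c \<odot>\<^bsub>?F\<^esub> f)"
      unfolding tensor_space_def using quotient_space_smult[OF F N c] by simp
    then show "h (c \<odot>\<^bsub>?T\<^esub> t) = c \<odot>\<^bsub>U\<^esub> h t"
      using c f by (simp add: h)
  qed
  moreover have "h \<in> extensional (carrier ?T)" by (simp add: h_def)
  moreover have "h (tensor K V W v w) = \<beta> v w" if "v \<in> carrier V" "w \<in> carrier W" for v w
    using that by (simp add: tensor_def h e \<phi>e)
  ultimately show "\<exists>h. h \<in> module_hom K ?T U \<and> h \<in> extensional (carrier ?T) \<and>
      (\<forall>v\<in>carrier V. \<forall>w\<in>carrier W. h (tensor K V W v w) = \<beta> v w)" by blast
next
  fix h h'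
  assume h: "h \<in> module_hom K (tensor_space K V W) U \<and>
      h \<in> extensional (carrier (tensor_space K V W)) \<and>
      (\<forall>v\<in>carrier V. \<forall>w\<in>carrier W. h (tensor K V W v w) = \<beta> v w)"
    and h': "h' \<in> module_hom K (tensor_space K V W) U \<and>
      h' \<in> extensional (carrier (tensor_space K V W)) \<and>
      (\<forall>v\<in>carrier V. \<forall>w\<in>carrier W. h' (tensor K V W v w) = \<beta> v w)"
  have "h t = h' t" if "t \<in> carrier (tensor_space K V W)" for t
    using VW U _ _ _ that by (rule tensor_hom_eqI) (use h h' in auto)
  then show "h = h'"
    using h h' by (blast intro: extensionalityI)
qed

lemma
  assumes "vectorspace K V" "vectorspace K W" "vectorspace K U" "bilinear_map K V W U \<beta>"
  shows tensor_lift_hom: "tensor_lift K V W U \<beta> \<in> module_hom K (tensor_space K V W) U"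
    and tensor_lift_tensor: "v \<in> carrier V \<Longrightarrow> w \<in> carrier W \<Longrightarrow>
      tensor_lift K V W U \<beta> (tensor K V W v w) = \<beta> v w"
  using theI'[OF tensor_universal[OF assms]] unfolding tensor_lift_def by auto

lemma tensor_map_bilinear:
  assumes "linear_map K V V' f" "linear_map K W W' g"
  shows "bilinear_map K V W (tensor_space K V' W') (\<lambda>v w. tensor K V' W' (f v) (g w))"
proof -
  interpret f: linear_map K V V' f by fact
  interpret g: linear_map K W W' g by fact
  have V': "vectorspace K V'" and W': "vectorspace K W'" by unfold_locales
  note b = tensor_bilinear[OF V' W']
  have 1: "(\<lambda>v. tensor K V' W' v w) \<in> module_hom K V' (tensor_space K V' W')" if "w \<in> carrier W'" for w
    using b that by (simp add: bilinear_map_def)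
  have 2: "tensor K V' W' v \<in> module_hom K W' (tensor_space K V' W')" if "v \<in> carrier V'" for v
    using b that by (simp add: bilinear_map_def)
  show ?thesis
    unfolding bilinear_map_def module_hom_def
    by (auto simp: tensor_closed[OF V' W'] module_hom_add[OF 1] module_hom_add[OF 2]
        module_hom_smult[OF 1] module_hom_smult[OF 2])
qed

lemma
  assumes f: "linear_map K V V' f" and g: "linear_map K W W' g"
  shows tensor_map_linear:
      "linear_map K (tensor_space K V W) (tensor_space K V' W') (tensor_map K V V' f W W' g)"
    and tensor_map_tensor: "v \<in> carrier V \<Longrightarrow> w \<in> carrier W \<Longrightarrow>
      tensor_map K V V' f W W' g (tensor K V W v w) = tensor K V' W' (f v) (g w)"
proof -
  interpret f: linear_map K V V' f by fact
  interpret g: linear_map K W W' g by fact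
  have vs: "vectorspace K V" "vectorspace K W" "vectorspace K V'" "vectorspace K W'"
    by unfold_locales
  note T = tensor_space_vectorspace[OF vs(1,2)] tensor_space_vectorspace[OF vs(3,4)]
  show "linear_map K (tensor_space K V W) (tensor_space K V' W') (tensor_map K V V' f W W' g)"
    unfolding tensor_map_def
    by (intro linear_map.intro mod_hom.intro mod_hom_axioms.intro tensor_lift_hom vs T
        tensor_map_bilinear[OF f g] vectorspace.axioms(1))
  show "tensor_map K V V' f W W' g (tensor K V W v w) = tensor K V' W' (f v) (g w)"
    if "v \<in> carrier V" "w \<in> carrier W"
    unfolding tensor_map_def
    using that by (simp add: tensor_lift_tensor[OF vs(1,2) T(2) tensor_map_bilinear[OF f g]])
qed

lemma
  assumes U: "vectorspace K U" and V: "vectorspace K V" and W: "vectorspace K W"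
  shows tensor_assoc_linear:
      "linear_map K (tensor_space K (tensor_space K U V) W)
         (tensor_space K U (tensor_space K V W)) (tensor_assoc K U V W)"
    and tensor_assoc_tensor:
      "u \<in> carrier U \<Longrightarrow> v \<in> carrier V \<Longrightarrow> w \<in> carrier W \<Longrightarrow>
       tensor_assoc K U V W (tensor K (tensor_space K U V) W (tensor K U V u v) w) =
         tensor K U (tensor_space K V W) u (tensor K V W v w)"
proof -
  let ?UV = "tensor_space K U V" and ?VW = "tensor_space K V W"
  let ?R = "tensor_space K U ?VW"
  have UV: "vectorspace K ?UV" and VW: "vectorspace K ?VW"
    by (intro tensor_space_vectorspace U V W)+
  have L: "vectorspace K (tensor_space K ?UV W)" and R: "vectorspace K ?R"
    by (intro tensor_space_vectorspace U W UV VW)+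
  interpret R: vectorspace K ?R by (rule R)
  note b1 = tensor_bilinear[OF U VW] and b2 = tensor_bilinear[OF V W]
  have 1: "(\<lambda>u. tensor K U ?VW u t) \<in> module_hom K U ?R" if "t \<in> carrier ?VW" for t
    using b1 that by (simp add: bilinear_map_def)
  have 2: "tensor K U ?VW u \<in> module_hom K ?VW ?R" if "u \<in> carrier U" for u
    using b1 that by (simp add: bilinear_map_def)
  have 3: "(\<lambda>v. tensor K V W v w) \<in> module_hom K V ?VW" if "w \<in> carrier W" for w
    using b2 that by (simp add: bilinear_map_def)
  have 4: "tensor K V W v \<in> module_hom K W ?VW" if "v \<in> carrier V" for v
    using b2 that by (simp add: bilinear_map_def)
  define \<beta> where "\<beta> = (\<lambda>w u v. tensor K U ?VW u (tensor K V W v w))"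
  define \<gamma> where "\<gamma> = (\<lambda>t w. tensor_lift K U V ?R (\<beta> w) t)"
  note cl = tensor_closed[OF V W] tensor_closed[OF U VW]
  have \<beta>: "bilinear_map K U V ?R (\<beta> w)" if "w \<in> carrier W" for w
    unfolding bilinear_map_def module_hom_def \<beta>_def
    using that by (auto simp: cl module_hom_add[OF 1] module_hom_add[OF 2] module_hom_add[OF 3]
        module_hom_smult[OF 1] module_hom_smult[OF 2] module_hom_smult[OF 3])
  have \<gamma>1: "(\<lambda>t. \<gamma> t w) \<in> module_hom K ?UV ?R" if "w \<in> carrier W" for w
    unfolding \<gamma>_def using tensor_lift_hom[OF U V R \<beta>[OF that]] by simp
  have \<gamma>c: "\<gamma> t w \<in> carrier ?R" if "t \<in> carrier ?UV" "w \<in> carrier W" for t w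
    using module_hom_closed[OF \<gamma>1] that by blast
  have \<gamma>t: "\<gamma> (tensor K U V u v) w = \<beta> w u v" if "u \<in> carrier U" "v \<in> carrier V" "w \<in> carrier W" for u v w
    unfolding \<gamma>_def using that by (intro tensor_lift_tensor U V R \<beta>)
  interpret W: vectorspace K W by (rule W)
  have \<gamma>a: "\<gamma> t (w \<oplus>\<^bsub>W\<^esub> w') = \<gamma> t w \<oplus>\<^bsub>?R\<^esub> \<gamma> t w'"
    if "t \<in> carrier ?UV" and w: "w \<in> carrier W" "w' \<in> carrier W" for t w w'
    using U V R _ _ _ that(1)
  proof (rule tensor_hom_eqI)
    show "(\<lambda>t. \<gamma> t (w \<oplus>\<^bsub>W\<^esub> w')) \<in> module_hom K ?UV ?R"
      using w by (intro \<gamma>1) simp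
    show "(\<lambda>t. \<gamma> t w \<oplus>\<^bsub>?R\<^esub> \<gamma> t w') \<in> module_hom K ?UV ?R"
      unfolding module_hom_def
      using w by (auto simp: \<gamma>c module_hom_add[OF \<gamma>1] module_hom_smult[OF \<gamma>1] R.smult_r_distr R.M.a_ac)
    show "\<gamma> (tensor K U V u v) (w \<oplus>\<^bsub>W\<^esub> w') = \<gamma> (tensor K U V u v) w \<oplus>\<^bsub>?R\<^esub> \<gamma> (tensor K U V u v) w'"
      if "u \<in> carrier U" "v \<in> carrier V" for u v
      using that w by (simp add: \<gamma>t \<beta>_def cl module_hom_add[OF 4] module_hom_add[OF 2])
  qed
  have \<gamma>s: "\<gamma> t (c \<odot>\<^bsub>W\<^esub> w) = c \<odot>\<^bsub>?R\<^esub> \<gamma> t w"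
    if "t \<in> carrier ?UV" and w: "c \<in> carrier K" "w \<in> carrier W" for t c w
    using U V R _ _ _ that(1)
  proof (rule tensor_hom_eqI)
    show "(\<lambda>t. \<gamma> t (c \<odot>\<^bsub>W\<^esub> w)) \<in> module_hom K ?UV ?R"
      using w by (intro \<gamma>1) simp
    show "(\<lambda>t. c \<odot>\<^bsub>?R\<^esub> \<gamma> t w) \<in> module_hom K ?UV ?R"
      unfolding module_hom_def
      using w by (auto simp: \<gamma>c module_hom_add[OF \<gamma>1] module_hom_smult[OF \<gamma>1] R.smult_r_distr
          R.smult_assoc1[symmetric] R.m_comm)
    show "\<gamma> (tensor K U V u v) (c \<odot>\<^bsub>W\<^esub> w) = c \<odot>\<^bsub>?R\<^esub> \<gamma> (tensor K U V u v) w"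
      if "u \<in> carrier U" "v \<in> carrier V" for u v
      using that w by (simp add: \<gamma>t \<beta>_def cl module_hom_smult[OF 4] module_hom_smult[OF 2])
  qed
  have \<gamma>: "bilinear_map K ?UV W ?R \<gamma>"
    unfolding bilinear_map_def using \<gamma>1 by (auto simp: module_hom_def \<gamma>c \<gamma>a \<gamma>s)
  have assoc: "tensor_assoc K U V W = tensor_lift K ?UV W ?R \<gamma>"
    unfolding tensor_assoc_def \<gamma>_def \<beta>_def ..
  show "linear_map K (tensor_space K ?UV W) ?R (tensor_assoc K U V W)"
    unfolding assoc
    by (intro linear_map.intro mod_hom.intro mod_hom_axioms.intro tensor_lift_hom L R UV W
        \<gamma> vectorspace.axioms(1))
  show "tensor_assoc K U V W (tensor K ?UV W (tensor K U V u v) w) =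
      tensor K U ?VW u (tensor K V W v w)"
    if "u \<in> carrier U" "v \<in> carrier V" "w \<in> carrier W"
    using that tensor_closed[OF U V]
    by (simp add: assoc tensor_lift_tensor[OF UV W R \<gamma>] \<gamma>t \<beta>_def)
qed


section \<open>Hom-coalgebras\<close>

context vectorspace
begin

abbreviation square :: "('a, ('c \<times> 'c \<Rightarrow> 'a) set) module" where
  "square \<equiv> tensor_space K V V"

abbreviation cube_left where
  "cube_left \<equiv> tensor_space K square V"

abbreviation cube_right where
  "cube_right \<equiv> tensor_space K V square"

abbreviation tensor_endo where
  "tensor_endo f g \<equiv> tensor_map K V V f V V g"

abbreviation tensor_left where
  "tensor_left \<delta> f \<equiv> tensor_map K V square \<delta> V V f"

abbreviation tensor_right where
  "tensor_right f \<delta> \<equiv> tensor_map K V V f V square \<delta>"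

abbreviation assoc where
  "assoc \<equiv> tensor_assoc K V V V"

end

text \<open>
  Equalities of maps into the triple tensor product identify \<open>(C \<otimes> C) \<otimes> C\<close> with
  \<open>C \<otimes> (C \<otimes> C)\<close>; this identification is written out as \<open>assoc\<close>.
\<close>

locale hom_coassociative_coalgebra = vectorspace K C for K and C +
  fixes \<Delta> \<alpha>
  assumes comult_linear: "linear_map K C square \<Delta>"
    and twist_linear: "linear_map K C C \<alpha>"
    and coassoc: "x \<in> carrier C \<Longrightarrow>
      tensor_right \<alpha> \<Delta> (\<Delta> x) = assoc (tensor_left \<Delta> \<alpha> (\<Delta> x))"

locale hom_coassociative_rota_baxter_coalgebra = hom_coassociative_coalgebra K C \<Delta> \<alpha>
  for K and C and \<Delta> and \<alpha> +
  fixes R and weight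
  assumes weight_closed: "weight \<in> carrier K"
    and rota_baxter_linear: "linear_map K C C R"
    and rota_baxter_twist: "x \<in> carrier C \<Longrightarrow> R (\<alpha> x) = \<alpha> (R x)"
    and rota_baxter: "x \<in> carrier C \<Longrightarrow>
      tensor_endo R R (\<Delta> x) =
        tensor_endo R id (\<Delta> (R x)) \<oplus>\<^bsub>square\<^esub> tensor_endo id R (\<Delta> (R x))
          \<oplus>\<^bsub>square\<^esub> weight \<odot>\<^bsub>square\<^esub> \<Delta> (R x)"

text \<open>The maps \<open>\<Delta>m\<close>, \<open>\<Delta>z\<close>, \<open>\<Delta>p\<close> are \<open>\<Delta>\<^bsub>-1\<^esub>\<close>, \<open>\<Delta>\<^bsub>0\<^esub>\<close>, \<open>\<Delta>\<^bsub>1\<^esub>\<close>.\<close>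

locale hom_tridendriform_coalgebra = vectorspace K C for K and C +
  fixes \<Delta>m \<Delta>z \<Delta>p \<alpha>
  assumes linear_m: "linear_map K C square \<Delta>m"
    and linear_z: "linear_map K C square \<Delta>z"
    and linear_p: "linear_map K C square \<Delta>p"
    and twist_linear: "linear_map K C C \<alpha>"
    and tridend1: "x \<in> carrier C \<Longrightarrow>
      assoc (tensor_left \<Delta>m \<alpha> (\<Delta>m x)) =
        tensor_right \<alpha> \<Delta>m (\<Delta>m x) \<oplus>\<^bsub>cube_right\<^esub> tensor_right \<alpha> \<Delta>p (\<Delta>m x)
          \<oplus>\<^bsub>cube_right\<^esub> tensor_right \<alpha> \<Delta>z (\<Delta>m x)"
    and tridend2: "x \<in> carrier C \<Longrightarrow>
      assoc (tensor_left \<Delta>p \<alpha> (\<Delta>m x)) = tensor_right \<alpha> \<Delta>m (\<Delta>p x)"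
    and tridend3: "x \<in> carrier C \<Longrightarrow>
      tensor_right \<alpha> \<Delta>p (\<Delta>p x) =
        assoc (tensor_left \<Delta>m \<alpha> (\<Delta>p x) \<oplus>\<^bsub>cube_left\<^esub> tensor_left \<Delta>p \<alpha> (\<Delta>p x)
          \<oplus>\<^bsub>cube_left\<^esub> tensor_left \<Delta>z \<alpha> (\<Delta>p x))"
    and tridend4: "x \<in> carrier C \<Longrightarrow>
      assoc (tensor_left \<Delta>m \<alpha> (\<Delta>z x)) = tensor_right \<alpha> \<Delta>p (\<Delta>z x)"
    and tridend5: "x \<in> carrier C \<Longrightarrow>
      assoc (tensor_left \<Delta>p \<alpha> (\<Delta>z x)) = tensor_right \<alpha> \<Delta>z (\<Delta>p x)"
    and tridend6: "x \<in> carrier C \<Longrightarrow>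
      assoc (tensor_left \<Delta>z \<alpha> (\<Delta>m x)) = tensor_right \<alpha> \<Delta>m (\<Delta>z x)"
    and tridend7: "x \<in> carrier C \<Longrightarrow>
      assoc (tensor_left \<Delta>z \<alpha> (\<Delta>z x)) = tensor_right \<alpha> \<Delta>z (\<Delta>z x)"

end

theory Submission
  imports Defs
begin

text \<open>
  Naturality of the associator turns Hom-coassociativity into the identity
  \<open>((f \<otimes> g)\<Delta> \<otimes> \<alpha>)(I \<otimes> k)\<Delta> = (\<alpha> \<otimes> (g \<otimes> k)\<Delta>)(f \<otimes> I)\<Delta>\<close> for all linear \<open>f\<close>, \<open>g\<close>, \<open>k\<close> such that
  \<open>f\<close> and \<open>k\<close> commute with \<open>\<alpha>\<close>. Every tridendriform axiom is an instance with
  \<open>f, g, k \<in> {I, R}\<close>, up to powers of the weight. In axioms (1) and (3) the operator \<open>(R \<otimes> R)\<Delta>\<close>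
  appears, and the Rota-Baxter identity rewrites it as \<open>(\<Delta>\<^bsub>-1\<^esub> + \<Delta>\<^bsub>1\<^esub> + \<lambda>\<Delta>)R\<close>.
\<close>

section \<open>Linear maps\<close>

lemma linear_mapI:
  assumes "vectorspace K V" "vectorspace K W" "f \<in> module_hom K V W"
  shows "linear_map K V W f"
  using assms by (intro linear_map.intro mod_hom.intro mod_hom_axioms.intro vectorspace.axioms(1))

text \<open>The locale facts are extracted as conditional rules so that they can be instantiated
  with \<open>OF\<close> at the many composite maps below.\<close>

lemma
  assumes "linear_map K V W f"
  shows linear_map_hom: "f \<in> module_hom K V W"
    and linear_map_closed: "v \<in> carrier V \<Longrightarrow> f v \<in> carrier W"
    and linear_map_add: "v \<in> carrier V \<Longrightarrow> v' \<in> carrier V \<Longrightarrow> f (v \<oplus>\<^bsub>V\<^esub> v') = f v \<oplus>\<^bsub>W\<^esub> f v'"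
    and linear_map_smult: "c \<in> carrier K \<Longrightarrow> v \<in> carrier V \<Longrightarrow> f (c \<odot>\<^bsub>V\<^esub> v) = c \<odot>\<^bsub>W\<^esub> f v"
    and linear_map_domain: "vectorspace K V"
    and linear_map_codomain: "vectorspace K W"
proof -
  interpret linear_map K V W f by fact
  show hom: "f \<in> module_hom K V W" by (rule f_hom)
  show "v \<in> carrier V \<Longrightarrow> f v \<in> carrier W" using hom by (auto simp: module_hom_def)
  show "v \<in> carrier V \<Longrightarrow> v' \<in> carrier V \<Longrightarrow> f (v \<oplus>\<^bsub>V\<^esub> v') = f v \<oplus>\<^bsub>W\<^esub> f v'"
    using hom by (rule module_hom_add)
  show "c \<in> carrier K \<Longrightarrow> v \<in> carrier V \<Longrightarrow> f (c \<odot>\<^bsub>V\<^esub> v) = c \<odot>\<^bsub>W\<^esub> f v"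
    using hom by (rule module_hom_smult)
  show "vectorspace K V" "vectorspace K W" by unfold_locales
qed

lemma linear_map_id: "vectorspace K V \<Longrightarrow> linear_map K V V id"
  by (intro linear_mapI) (auto simp: module_hom_def)

lemma linear_map_comp:
  assumes f: "linear_map K U V f" and g: "linear_map K V W g"
  shows "linear_map K U W (g \<circ> f)"
  using linear_map_domain[OF f] linear_map_codomain[OF g]
proof (rule linear_mapI)
  show "g \<circ> f \<in> module_hom K U W"
    by (auto simp: module_hom_def linear_map_closed[OF f] linear_map_closed[OF g]
        linear_map_add[OF f] linear_map_add[OF g] linear_map_smult[OF f] linear_map_smult[OF g])
qed

lemma linear_map_sum:
  assumes f: "linear_map K V W f" and g: "linear_map K V W g"
  shows "linear_map K V W (\<lambda>v. f v \<oplus>\<^bsub>W\<^esub> g v)"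
  using linear_map_domain[OF f] linear_map_codomain[OF f]
proof (rule linear_mapI)
  interpret W: vectorspace K W by (rule linear_map_codomain[OF f])
  show "(\<lambda>v. f v \<oplus>\<^bsub>W\<^esub> g v) \<in> module_hom K V W"
    by (auto simp: module_hom_def linear_map_closed[OF f] linear_map_closed[OF g]
        linear_map_add[OF f] linear_map_add[OF g] linear_map_smult[OF f] linear_map_smult[OF g]
        W.smult_r_distr W.M.a_ac)
qed

lemma linear_map_scale:
  assumes f: "linear_map K V W f" and c: "c \<in> carrier K"
  shows "linear_map K V W (\<lambda>v. c \<odot>\<^bsub>W\<^esub> f v)"
  using linear_map_domain[OF f] linear_map_codomain[OF f]
proof (rule linear_mapI)
  interpret W: vectorspace K W by (rule linear_map_codomain[OF f])
  show "(\<lambda>v. c \<odot>\<^bsub>W\<^esub> f v) \<in> module_hom K V W"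
    \<comment> \<open>Homogeneity has to exchange \<open>c\<close> with the other scalar, which is
      commutativity of \<open>K\<close>.\<close>
    using c by (auto simp: module_hom_def linear_map_closed[OF f] linear_map_add[OF f]
        linear_map_smult[OF f] W.smult_r_distr W.smult_assoc1[symmetric] W.m_comm)
qed

section \<open>Tensor products of linear maps\<close>

text \<open>Elementary tensors span the tensor product. Since sums, multiples and composites of
  linear maps are again linear, this rule turns the identities below into computations on elementary
  tensors.\<close>

lemma tensor_linear_map_eqI:
  assumes "vectorspace K V" "vectorspace K W"
    and h: "linear_map K (tensor_space K V W) U h" "linear_map K (tensor_space K V W) U h'"
    and "\<And>v w. v \<in> carrier V \<Longrightarrow> w \<in> carrier W \<Longrightarrow> h (tensor K V W v w) = h' (tensor K V W v w)"
    and "t \<in> carrier (tensor_space K V W)"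
  shows "h t = h' t"
  by (rule tensor_hom_eqI[OF assms(1,2) linear_map_codomain[OF h(1)] linear_map_hom[OF h(1)]
        linear_map_hom[OF h(2)] assms(5,6)])

lemma
  assumes V: "vectorspace K V" and W: "vectorspace K W"
  shows tensor_add_left: "v \<in> carrier V \<Longrightarrow> v' \<in> carrier V \<Longrightarrow> w \<in> carrier W \<Longrightarrow>
      tensor K V W (v \<oplus>\<^bsub>V\<^esub> v') w = tensor K V W v w \<oplus>\<^bsub>tensor_space K V W\<^esub> tensor K V W v' w"
    and tensor_add_right: "v \<in> carrier V \<Longrightarrow> w \<in> carrier W \<Longrightarrow> w' \<in> carrier W \<Longrightarrow>
      tensor K V W v (w \<oplus>\<^bsub>W\<^esub> w') = tensor K V W v w \<oplus>\<^bsub>tensor_space K V W\<^esub> tensor K V W v w'"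
    and tensor_smult_left: "c \<in> carrier K \<Longrightarrow> v \<in> carrier V \<Longrightarrow> w \<in> carrier W \<Longrightarrow>
      tensor K V W (c \<odot>\<^bsub>V\<^esub> v) w = c \<odot>\<^bsub>tensor_space K V W\<^esub> tensor K V W v w"
    and tensor_smult_right: "c \<in> carrier K \<Longrightarrow> v \<in> carrier V \<Longrightarrow> w \<in> carrier W \<Longrightarrow>
      tensor K V W v (c \<odot>\<^bsub>W\<^esub> w) = c \<odot>\<^bsub>tensor_space K V W\<^esub> tensor K V W v w"
  using tensor_bilinear[OF V W] by (auto simp: bilinear_map_def module_hom_def)

section \<open>Functoriality and bilinearity of the tensor product of maps\<close>

lemma tensor_map_closed:
  assumes "linear_map K V V' f" "linear_map K W W' g" "t \<in> carrier (tensor_space K V W)"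
  shows "tensor_map K V V' f W W' g t \<in> carrier (tensor_space K V' W')"
  by (rule linear_map_closed[OF tensor_map_linear[OF assms(1,2)] assms(3)])

lemma tensor_map_id:
  assumes "vectorspace K V" "vectorspace K W" "t \<in> carrier (tensor_space K V W)"
  shows "tensor_map K V V id W W id t = t"
proof -
  have "tensor_map K V V id W W id t = id t"
    by (rule tensor_linear_map_eqI[OF assms(1,2) tensor_map_linear linear_map_id _ assms(3)])
      (simp_all add: assms linear_map_id tensor_space_vectorspace tensor_map_tensor)
  then show ?thesis by simp
qed

text \<open>Commutation with \<alpha> and the Rota-Baxter identity are known on the carrier only, so
  the maps involved need not be equal as HOL functions and cannot be rewritten inside
  \<open>tensor_map\<close>. This rule takes the place of such rewriting.\<close>

lemma tensor_map_cong:
  assumes f: "linear_map K V V' f" and f': "linear_map K V V' f'"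
    and g: "linear_map K W W' g" and g': "linear_map K W W' g'"
    and "\<And>v. v \<in> carrier V \<Longrightarrow> f v = f' v" "\<And>w. w \<in> carrier W \<Longrightarrow> g w = g' w"
    and t: "t \<in> carrier (tensor_space K V W)"
  shows "tensor_map K V V' f W W' g t = tensor_map K V V' f' W W' g' t"
  by (rule tensor_linear_map_eqI[OF linear_map_domain[OF f] linear_map_domain[OF g]
        tensor_map_linear[OF f g] tensor_map_linear[OF f' g'] _ t])
    (simp add: tensor_map_tensor[OF f g] tensor_map_tensor[OF f' g'] assms)

text \<open>Both sides send v \<otimes> w to f'(f v) \<otimes> g'(g w). The rule collapses layered
  tensor maps into one, which can then be compared factor by factor.\<close>

lemma tensor_map_comp:
  assumes f: "linear_map K V V' f" and f': "linear_map K V' V'' f'"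
    and g: "linear_map K W W' g" and g': "linear_map K W' W'' g'"
    and t: "t \<in> carrier (tensor_space K V W)"
  shows "tensor_map K V' V'' f' W' W'' g' (tensor_map K V V' f W W' g t) =
    tensor_map K V V'' (f' \<circ> f) W W'' (g' \<circ> g) t"
proof -
  note F = linear_map_comp[OF f f'] and G = linear_map_comp[OF g g']
  have "(tensor_map K V' V'' f' W' W'' g' \<circ> tensor_map K V V' f W W' g) t =
      tensor_map K V V'' (f' \<circ> f) W W'' (g' \<circ> g) t"
    by (rule tensor_linear_map_eqI[OF linear_map_domain[OF f] linear_map_domain[OF g]
          linear_map_comp[OF tensor_map_linear[OF f g] tensor_map_linear[OF f' g']]
          tensor_map_linear[OF F G] _ t])
      (simp add: tensor_map_tensor[OF f g] tensor_map_tensor[OF f' g'] tensor_map_tensor[OF F G]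
        linear_map_closed[OF f] linear_map_closed[OF g])
  then show ?thesis by simp
qed

text \<open>Additivity of elementary tensors in the first argument is behind this. Together with its
  mirror image it expands a sum of comultiplications that occurs as a tensor factor.\<close>

lemma tensor_map_sum_left:
  assumes f: "linear_map K V V' f" and f': "linear_map K V V' f'" and g: "linear_map K W W' g"
    and t: "t \<in> carrier (tensor_space K V W)"
  shows "tensor_map K V V' (\<lambda>v. f v \<oplus>\<^bsub>V'\<^esub> f' v) W W' g t =
    tensor_map K V V' f W W' g t \<oplus>\<^bsub>tensor_space K V' W'\<^esub> tensor_map K V V' f' W W' g t"
  by (rule tensor_linear_map_eqI[OF linear_map_domain[OF f] linear_map_domain[OF g]
        tensor_map_linear[OF linear_map_sum[OF f f'] g]
        linear_map_sum[OF tensor_map_linear[OF f g] tensor_map_linear[OF f' g]] _ t])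
    (simp add: tensor_map_tensor[OF f g] tensor_map_tensor[OF f' g]
      tensor_map_tensor[OF linear_map_sum[OF f f'] g]
      tensor_add_left[OF linear_map_codomain[OF f] linear_map_codomain[OF g]]
      linear_map_closed[OF f] linear_map_closed[OF f'] linear_map_closed[OF g])

lemma tensor_map_sum_right:
  assumes f: "linear_map K V V' f" and g: "linear_map K W W' g" and g': "linear_map K W W' g'"
    and t: "t \<in> carrier (tensor_space K V W)"
  shows "tensor_map K V V' f W W' (\<lambda>w. g w \<oplus>\<^bsub>W'\<^esub> g' w) t =
    tensor_map K V V' f W W' g t \<oplus>\<^bsub>tensor_space K V' W'\<^esub> tensor_map K V V' f W W' g' t"
  by (rule tensor_linear_map_eqI[OF linear_map_domain[OF f] linear_map_domain[OF g]
        tensor_map_linear[OF f linear_map_sum[OF g g']]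
        linear_map_sum[OF tensor_map_linear[OF f g] tensor_map_linear[OF f g']] _ t])
    (simp add: tensor_map_tensor[OF f g] tensor_map_tensor[OF f g']
      tensor_map_tensor[OF f linear_map_sum[OF g g']]
      tensor_add_right[OF linear_map_codomain[OF f] linear_map_codomain[OF g]]
      linear_map_closed[OF f] linear_map_closed[OF g] linear_map_closed[OF g'])

lemma tensor_map_scale_left:
  assumes f: "linear_map K V V' f" and g: "linear_map K W W' g" and c: "c \<in> carrier K"
    and t: "t \<in> carrier (tensor_space K V W)"
  shows "tensor_map K V V' (\<lambda>v. c \<odot>\<^bsub>V'\<^esub> f v) W W' g t =
    c \<odot>\<^bsub>tensor_space K V' W'\<^esub> tensor_map K V V' f W W' g t"
  by (rule tensor_linear_map_eqI[OF linear_map_domain[OF f] linear_map_domain[OF g]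
        tensor_map_linear[OF linear_map_scale[OF f c] g]
        linear_map_scale[OF tensor_map_linear[OF f g] c] _ t])
    (simp add: c tensor_map_tensor[OF f g] tensor_map_tensor[OF linear_map_scale[OF f c] g]
      tensor_smult_left[OF linear_map_codomain[OF f] linear_map_codomain[OF g]]
      linear_map_closed[OF f] linear_map_closed[OF g])

lemma tensor_map_scale_right:
  assumes f: "linear_map K V V' f" and g: "linear_map K W W' g" and c: "c \<in> carrier K"
    and t: "t \<in> carrier (tensor_space K V W)"
  shows "tensor_map K V V' f W W' (\<lambda>w. c \<odot>\<^bsub>W'\<^esub> g w) t =
    c \<odot>\<^bsub>tensor_space K V' W'\<^esub> tensor_map K V V' f W W' g t"
  by (rule tensor_linear_map_eqI[OF linear_map_domain[OF f] linear_map_domain[OF g]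
        tensor_map_linear[OF f linear_map_scale[OF g c]]
        linear_map_scale[OF tensor_map_linear[OF f g] c] _ t])
    (simp add: c tensor_map_tensor[OF f g] tensor_map_tensor[OF f linear_map_scale[OF g c]]
      tensor_smult_right[OF linear_map_codomain[OF f] linear_map_codomain[OF g]]
      linear_map_closed[OF f] linear_map_closed[OF g])

text \<open>Both composites send (u \<otimes> v) \<otimes> w to f u \<otimes> (g v \<otimes> h w).
  As the tensors are nested, the reduction to elementary tensors is made twice.\<close>

lemma tensor_assoc_natural:
  assumes f: "linear_map K U U' f" and g: "linear_map K V V' g" and h: "linear_map K W W' h"
    and t: "t \<in> carrier (tensor_space K (tensor_space K U V) W)"
  shows "tensor_assoc K U' V' W'
      (tensor_map K (tensor_space K U V) (tensor_space K U' V') (tensor_map K U U' f V V' g) W W' h t) =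
    tensor_map K U U' f (tensor_space K V W) (tensor_space K V' W') (tensor_map K V V' g W W' h)
      (tensor_assoc K U V W t)"
proof -
  note dom = linear_map_domain[OF f] linear_map_domain[OF g] linear_map_domain[OF h]
  note cod = linear_map_codomain[OF f] linear_map_codomain[OF g] linear_map_codomain[OF h]
  let ?UV = "tensor_space K U V" and ?R = "tensor_space K U' (tensor_space K V' W')"
  let ?l = "tensor_assoc K U' V' W' \<circ>
    tensor_map K ?UV (tensor_space K U' V') (tensor_map K U U' f V V' g) W W' h"
  let ?r = "tensor_map K U U' f (tensor_space K V W) (tensor_space K V' W')
    (tensor_map K V V' g W W' h) \<circ> tensor_assoc K U V W"
  note fg = tensor_map_linear[OF f g] and gh = tensor_map_linear[OF g h]
  note UV = tensor_space_vectorspace[OF dom(1,2)] and VW = tensor_space_vectorspace[OF dom(2,3)]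
  have l: "linear_map K (tensor_space K ?UV W) ?R ?l"
    by (rule linear_map_comp[OF tensor_map_linear[OF fg h] tensor_assoc_linear[OF cod]])
  have r: "linear_map K (tensor_space K ?UV W) ?R ?r"
    by (rule linear_map_comp[OF tensor_assoc_linear[OF dom] tensor_map_linear[OF f gh]])
  \<comment> \<open>The first reduction leaves \<open>s\<close> arbitrary in U \<otimes> V.
    Precomposing with this map at a fixed \<open>w\<close> permits the second one, to s = u
    \<otimes> v.\<close>
  have slice: "linear_map K ?UV (tensor_space K ?UV W) (\<lambda>s. tensor K ?UV W s w)"
    if "w \<in> carrier W" for w
    using that tensor_bilinear[OF UV dom(3)]
    by (intro linear_mapI UV tensor_space_vectorspace dom) (simp add: bilinear_map_def)
  have "?l t = ?r t"
  proof (rule tensor_linear_map_eqI[OF UV dom(3) l r _ t])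
    fix s w assume s: "s \<in> carrier ?UV" and w: "w \<in> carrier W"
    have "(?l \<circ> (\<lambda>s. tensor K ?UV W s w)) s = (?r \<circ> (\<lambda>s. tensor K ?UV W s w)) s"
      by (rule tensor_linear_map_eqI[OF dom(1,2) linear_map_comp[OF slice[OF w] l]
            linear_map_comp[OF slice[OF w] r] _ s])
        (simp add: w tensor_map_tensor[OF f g] tensor_map_tensor[OF g h] tensor_map_tensor[OF fg h]
          tensor_map_tensor[OF f gh] tensor_assoc_tensor[OF dom] tensor_assoc_tensor[OF cod]
          tensor_closed[OF dom(1,2)] tensor_closed[OF dom(2,3)]
          linear_map_closed[OF f] linear_map_closed[OF g] linear_map_closed[OF h])
    then show "?l (tensor K ?UV W s w) = ?r (tensor K ?UV W s w)" by simp
  qed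
  then show ?thesis by simp
qed

section \<open>Rota-Baxter coalgebras\<close>

context hom_coassociative_coalgebra
begin

text \<open>The maps \<open>f\<close>, \<open>g\<close>, \<open>k\<close> act on the three legs of
  the iterated coproduct. The twist shares the third leg with \<open>k\<close> on one side and the
  first leg with \<open>f\<close> on the other, so these two are moved past it; \<open>g\<close>
  sits on the middle leg and never meets it.\<close>

lemma twisted_coassoc:
  assumes f: "linear_map K C C f" and g: "linear_map K C C g" and k: "linear_map K C C k"
    and f\<alpha>: "\<And>x. x \<in> carrier C \<Longrightarrow> f (\<alpha> x) = \<alpha> (f x)"
    and k\<alpha>: "\<And>x. x \<in> carrier C \<Longrightarrow> k (\<alpha> x) = \<alpha> (k x)"
    and x: "x \<in> carrier C"
  shows "assoc (tensor_left (tensor_endo f g \<circ> \<Delta>) \<alpha> (tensor_endo id k (\<Delta> x))) =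
    tensor_right \<alpha> (tensor_endo g k \<circ> \<Delta>) (tensor_endo f id (\<Delta> x))"
proof -
  note C = linear_map_id[OF vectorspace_axioms] and \<alpha> = twist_linear and \<Delta> = comult_linear
  note fg = tensor_map_linear[OF f g] and gk = tensor_map_linear[OF g k]
  note \<Delta>x = linear_map_closed[OF \<Delta> x]
  note fg\<Delta> = linear_map_comp[OF \<Delta> fg] and gk\<Delta> = linear_map_comp[OF \<Delta> gk]
  have left: "tensor_left (tensor_endo f g \<circ> \<Delta>) \<alpha> (tensor_endo id k (\<Delta> x)) =
      tensor_map K square square (tensor_endo f g) C C k (tensor_left \<Delta> \<alpha> (\<Delta> x))"
    \<comment> \<open>Once the layers are merged, the second factors are
      \<open>\<alpha> \<circ> k\<close> and \<open>k \<circ> \<alpha>\<close>, which agree on the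
      carrier.\<close>
    unfolding tensor_map_comp[OF C fg\<Delta> k \<alpha> \<Delta>x] tensor_map_comp[OF \<Delta> fg \<alpha> k \<Delta>x]
    by (rule tensor_map_cong[OF linear_map_comp[OF C fg\<Delta>] linear_map_comp[OF \<Delta> fg]
          linear_map_comp[OF k \<alpha>] linear_map_comp[OF \<alpha> k] _ _ \<Delta>x])
      (simp_all add: k\<alpha>)
  have right: "tensor_right \<alpha> (tensor_endo g k \<circ> \<Delta>) (tensor_endo f id (\<Delta> x)) =
      tensor_map K C C f square square (tensor_endo g k) (tensor_right \<alpha> \<Delta> (\<Delta> x))"
    unfolding tensor_map_comp[OF f \<alpha> C gk\<Delta> \<Delta>x] tensor_map_comp[OF \<alpha> f \<Delta> gk \<Delta>x]
    by (rule tensor_map_cong[OF linear_map_comp[OF f \<alpha>] linear_map_comp[OF \<alpha> f]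
          linear_map_comp[OF C gk\<Delta>] linear_map_comp[OF \<Delta> gk] _ _ \<Delta>x])
      (simp_all add: f\<alpha>)
  show ?thesis
    unfolding left right coassoc[OF x]
    by (rule tensor_assoc_natural[OF f g k tensor_map_closed[OF \<Delta> \<alpha> \<Delta>x]])
qed

end

section \<open>Comultiplications derived from the Rota-Baxter operator\<close>

context hom_coassociative_rota_baxter_coalgebra
begin

definition comult_minus where
  "comult_minus = tensor_endo id R \<circ> \<Delta>"

definition comult_plus where
  "comult_plus = tensor_endo R id \<circ> \<Delta>"

definition comult_zero where
  "comult_zero = (\<lambda>x. weight \<odot>\<^bsub>square\<^esub> \<Delta> x)"

text \<open>Dual to the total product of a tridendriform algebra; the summands stand in the order of
  the Rota-Baxter identity.\<close>

definition comult_total where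
  "comult_total = (\<lambda>x. comult_plus x \<oplus>\<^bsub>square\<^esub> comult_minus x \<oplus>\<^bsub>square\<^esub> comult_zero x)"

lemma id_linear: "linear_map K C C id"
  by (rule linear_map_id[OF vectorspace_axioms])

lemma
  shows comult_minus_linear: "linear_map K C square comult_minus"
    and comult_plus_linear: "linear_map K C square comult_plus"
    and comult_zero_linear: "linear_map K C square comult_zero"
  unfolding comult_minus_def comult_plus_def comult_zero_def
  by (rule linear_map_comp[OF comult_linear] linear_map_scale tensor_map_linear comult_linear
      id_linear rota_baxter_linear weight_closed)+

lemmas comult_linears = comult_minus_linear comult_plus_linear comult_zero_linear

lemma comult_total_linear: "linear_map K C square comult_total"
  unfolding comult_total_def by (intro linear_map_sum comult_linears)

lemmas comult_closed = linear_map_closed[OF comult_linear]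

text \<open>This releases the weight when \<open>comult_zero x\<close> is the argument of a linear
  map; when \<open>comult_zero\<close> is itself a tensor factor,
  \<open>tensor_map_scale_left\<close> and \<open>tensor_map_scale_right\<close> do so.\<close>

lemma comult_zero_scale:
  assumes "x \<in> carrier C"
    and "linear_map K square U h"
  shows "h (comult_zero x) = weight \<odot>\<^bsub>U\<^esub> h (\<Delta> x)"
  unfolding comult_zero_def
  by (rule linear_map_smult[OF assms(2) weight_closed comult_closed[OF assms(1)]])

lemma tensor_endo_id: "x \<in> carrier C \<Longrightarrow> tensor_endo id id (\<Delta> x) = \<Delta> x"
  by (rule tensor_map_id[OF vectorspace_axioms vectorspace_axioms comult_closed])

text \<open>The Rota-Baxter identity in composed form, so that functoriality can separate
  \<open>R\<close> from \<open>comult_total\<close>.\<close>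

lemma rota_baxter_total:
  assumes "x \<in> carrier C"
  shows "(tensor_endo R R \<circ> \<Delta>) x = (comult_total \<circ> R) x"
  using rota_baxter[OF assms]
  by (simp add: comult_total_def comult_plus_def comult_minus_def comult_zero_def)

section \<open>The Rota-Baxter identity inside a tensor factor\<close>

lemma tensor_left_total:
  assumes "t \<in> carrier square"
  shows "tensor_left comult_total \<alpha> t =
    tensor_left comult_plus \<alpha> t \<oplus>\<^bsub>cube_left\<^esub> tensor_left comult_minus \<alpha> t
      \<oplus>\<^bsub>cube_left\<^esub> tensor_left comult_zero \<alpha> t"
  unfolding comult_total_def
  by (simp add: tensor_map_sum_left linear_map_sum comult_linears twist_linear assms)

lemma tensor_right_total:
  assumes "t \<in> carrier square"
  shows "tensor_right \<alpha> comult_total t =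
    tensor_right \<alpha> comult_plus t \<oplus>\<^bsub>cube_right\<^esub> tensor_right \<alpha> comult_minus t
      \<oplus>\<^bsub>cube_right\<^esub> tensor_right \<alpha> comult_zero t"
  unfolding comult_total_def
  by (simp add: tensor_map_sum_right linear_map_sum comult_linears twist_linear assms)

text \<open>The \<open>R\<close> split off from \<open>comult_total \<circ> R\<close> acts on the
  left leg of \<open>\<Delta> x\<close> and so produces \<open>comult_plus x\<close>.\<close>

lemma tensor_left_rota_baxter:
  assumes x: "x \<in> carrier C"
  shows "tensor_left (tensor_endo R R \<circ> \<Delta>) \<alpha> (\<Delta> x) = tensor_left comult_total \<alpha> (comult_plus x)"
proof -
  \<comment> \<open>The \<open>id\<close> is inserted to make the second factor a composite too, as
    \<open>tensor_map_comp\<close> expects.\<close>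
  have "tensor_left (tensor_endo R R \<circ> \<Delta>) \<alpha> (\<Delta> x) = tensor_left (comult_total \<circ> R) (\<alpha> \<circ> id) (\<Delta> x)"
    by (rule tensor_map_cong)
      (use rota_baxter_total in \<open>auto intro!: linear_map_comp tensor_map_linear rota_baxter_linear
        comult_linear comult_total_linear twist_linear id_linear comult_closed x\<close>)
  then show ?thesis
    by (simp add: comult_plus_def tensor_map_comp[OF rota_baxter_linear comult_total_linear id_linear
          twist_linear comult_closed[OF x]])
qed

text \<open>Here the \<open>R\<close> that is split off acts on the right leg, which produces
  \<open>comult_minus x\<close>.\<close>

lemma tensor_right_rota_baxter:
  assumes x: "x \<in> carrier C"
  shows "tensor_right \<alpha> (tensor_endo R R \<circ> \<Delta>) (\<Delta> x) = tensor_right \<alpha> comult_total (comult_minus x)"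
proof -
  have "tensor_right \<alpha> (tensor_endo R R \<circ> \<Delta>) (\<Delta> x) = tensor_right (\<alpha> \<circ> id) (comult_total \<circ> R) (\<Delta> x)"
    by (rule tensor_map_cong)
      (use rota_baxter_total in \<open>auto intro!: linear_map_comp tensor_map_linear rota_baxter_linear
        comult_linear comult_total_linear twist_linear id_linear comult_closed x\<close>)
  then show ?thesis
    by (simp add: comult_minus_def tensor_map_comp[OF id_linear twist_linear rota_baxter_linear
          comult_total_linear comult_closed[OF x]])
qed

section \<open>Verification of the seven axioms\<close>

theorem hom_tridendriform:
  "hom_tridendriform_coalgebra K C comult_minus comult_zero comult_plus \<alpha>"
proof (intro hom_tridendriform_coalgebra.intro hom_tridendriform_coalgebra_axioms.intro)
  note [simp] = linear_map_closed[OF comult_minus_linear] linear_map_closed[OF comult_plus_linear]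
    linear_map_closed[OF comult_zero_linear] linear_map_closed[OF comult_total_linear]
    comult_closed weight_closed
  note I = id_linear and R = rota_baxter_linear and \<alpha> = twist_linear
  note TL = tensor_map_linear[OF _ \<alpha>] and TR = tensor_map_linear[OF \<alpha>]
  note AL = tensor_assoc_linear[OF vectorspace_axioms vectorspace_axioms vectorspace_axioms]
  note sq = tensor_space_vectorspace[OF vectorspace_axioms vectorspace_axioms]
  interpret L: vectorspace K cube_left by (rule tensor_space_vectorspace[OF sq vectorspace_axioms])
  interpret P: vectorspace K cube_right by (rule tensor_space_vectorspace[OF vectorspace_axioms sq])
  have zero_left: "tensor_left comult_zero \<alpha> t = weight \<odot>\<^bsub>cube_left\<^esub> tensor_left \<Delta> \<alpha> t"
    and zero_right: "tensor_right \<alpha> comult_zero t = weight \<odot>\<^bsub>cube_right\<^esub> tensor_right \<alpha> \<Delta> t"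
    if "t \<in> carrier square" for t
    unfolding comult_zero_def
    by (intro tensor_map_scale_left tensor_map_scale_right comult_linear \<alpha> weight_closed that)+
  \<comment> \<open>\<open>tensor_endo id id \<circ> \<Delta>\<close> and \<open>\<Delta>\<close>
    agree on the carrier but need not be equal functions, so a congruence argument is used.\<close>
  have endo_id: "tensor_left (tensor_endo id id \<circ> \<Delta>) \<alpha> t = tensor_left \<Delta> \<alpha> t"
    "tensor_right \<alpha> (tensor_endo id id \<circ> \<Delta>) t = tensor_right \<alpha> \<Delta> t" if "t \<in> carrier square" for t
    by (intro tensor_map_cong; auto intro!: linear_map_comp[OF comult_linear] tensor_map_linear I
        comult_linear \<alpha> that simp: tensor_endo_id)+
  have assoc_scale: "assoc (c \<odot>\<^bsub>cube_left\<^esub> t) = c \<odot>\<^bsub>cube_right\<^esub> assoc t"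
    if "c \<in> carrier K" "t \<in> carrier cube_left" for c t
    using that by (rule linear_map_smult[OF AL])
  note cl = tensor_map_closed[OF _ \<alpha>] tensor_map_closed[OF \<alpha>]
  fix x assume x: "x \<in> carrier C"
  note left_scale = comult_zero_scale[OF x TL] and right_scale = comult_zero_scale[OF x TR]
  \<comment> \<open>Axiom (1) comes from \<open>f = I\<close>, \<open>g = k = R\<close>.\<close>
  have RR: "assoc (tensor_left comult_minus \<alpha> (comult_minus x)) =
      tensor_right \<alpha> (tensor_endo R R \<circ> \<Delta>) (\<Delta> x)"
    using twisted_coassoc[OF I R R _ rota_baxter_twist x] x
    by (simp add: comult_minus_def tensor_endo_id)
  show "assoc (tensor_left comult_minus \<alpha> (comult_minus x)) =
      tensor_right \<alpha> comult_minus (comult_minus x) \<oplus>\<^bsub>cube_right\<^esub>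
      tensor_right \<alpha> comult_plus (comult_minus x) \<oplus>\<^bsub>cube_right\<^esub>
      tensor_right \<alpha> comult_zero (comult_minus x)"
    \<comment> \<open>The expansion of \<open>comult_total\<close> lists the plus term first;
      commutativity restores the order of the axiom.\<close>
    using x by (simp add: RR tensor_right_rota_baxter tensor_right_total cl comult_linears P.M.a_comm)
  \<comment> \<open>Axiom (2) is the case \<open>f = k = R\<close>, \<open>g = I\<close>.\<close>
  show "assoc (tensor_left comult_plus \<alpha> (comult_minus x)) =
      tensor_right \<alpha> comult_minus (comult_plus x)"
    using twisted_coassoc[OF R I R rota_baxter_twist rota_baxter_twist x]
    by (simp add: comult_minus_def comult_plus_def)
  \<comment> \<open>Axiom (3) comes from \<open>f = g = R\<close>, \<open>k = I\<close>.\<close>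
  have RR': "tensor_right \<alpha> comult_plus (comult_plus x) =
      assoc (tensor_left (tensor_endo R R \<circ> \<Delta>) \<alpha> (\<Delta> x))"
    using twisted_coassoc[OF R R I rota_baxter_twist _ x] x
    by (simp add: comult_plus_def tensor_endo_id)
  show "tensor_right \<alpha> comult_plus (comult_plus x) =
      assoc (tensor_left comult_minus \<alpha> (comult_plus x) \<oplus>\<^bsub>cube_left\<^esub>
        tensor_left comult_plus \<alpha> (comult_plus x) \<oplus>\<^bsub>cube_left\<^esub>
        tensor_left comult_zero \<alpha> (comult_plus x))"
    using x by (simp add: RR' tensor_left_rota_baxter tensor_left_total cl comult_linears L.M.a_comm)
  \<comment> \<open>Axioms (4) to (6) contain a single \<open>R\<close>, in the place of
    \<open>g\<close>, \<open>f\<close> and \<open>k\<close> respectively. Each is first proved with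
    \<open>\<Delta>\<close> for \<open>comult_zero\<close>; then one factor of the weight is pulled
    out of both sides.\<close>
  have 4: "assoc (tensor_left comult_minus \<alpha> (\<Delta> x)) = tensor_right \<alpha> comult_plus (\<Delta> x)"
    using twisted_coassoc[OF I R I _ _ x] x
    by (simp add: comult_minus_def comult_plus_def tensor_endo_id)
  show "assoc (tensor_left comult_minus \<alpha> (comult_zero x)) =
      tensor_right \<alpha> comult_plus (comult_zero x)"
    using x 4 by (simp add: left_scale right_scale comult_linears assoc_scale cl)
  have 5: "assoc (tensor_left comult_plus \<alpha> (\<Delta> x)) = tensor_right \<alpha> \<Delta> (comult_plus x)"
    using twisted_coassoc[OF R I I rota_baxter_twist _ x] x
      endo_id(2)[OF linear_map_closed[OF comult_plus_linear x]]
    by (simp add: comult_plus_def tensor_endo_id)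
  show "assoc (tensor_left comult_plus \<alpha> (comult_zero x)) =
      tensor_right \<alpha> comult_zero (comult_plus x)"
    \<comment> \<open>The weight comes from the argument on the left and from the tensor factor on
      the right; in axiom (6) it is the other way round.\<close>
    using x 5 by (simp add: left_scale zero_right comult_linears assoc_scale cl)
  have 6: "assoc (tensor_left \<Delta> \<alpha> (comult_minus x)) = tensor_right \<alpha> comult_minus (\<Delta> x)"
    using twisted_coassoc[OF I I R _ rota_baxter_twist x] x
      endo_id(1)[OF linear_map_closed[OF comult_minus_linear x]]
    by (simp add: comult_minus_def tensor_endo_id)
  show "assoc (tensor_left comult_zero \<alpha> (comult_minus x)) =
      tensor_right \<alpha> comult_minus (comult_zero x)"
    using x 6 by (simp add: right_scale zero_left comult_linears comult_linear assoc_scale cl)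
  \<comment> \<open>Axiom (7) is Hom-coassociativity scaled by the weight twice, once for the
    argument and once for the tensor factor.\<close>
  show "assoc (tensor_left comult_zero \<alpha> (comult_zero x)) =
      tensor_right \<alpha> comult_zero (comult_zero x)"
    using x coassoc[OF x]
    by (simp add: left_scale right_scale zero_left zero_right comult_linears comult_linear
        assoc_scale cl)
qed (rule comult_linears twist_linear vectorspace_axioms)+

end

theorem theorem3p11:
  fixes K :: "('k, 'r) ring_scheme"
    and C :: "('k, 'c, 'm) module_scheme"
    and \<Delta> :: "'c \<Rightarrow> ('c \<times> 'c \<Rightarrow> 'k) set"
    and \<alpha> R :: "'c \<Rightarrow> 'c"
    and weight :: 'k
  assumes field: "field K"
    and char_0: "\<And>n :: nat. n > 0 \<Longrightarrow> [n] \<cdot>\<^bsub>K\<^esub> \<one>\<^bsub>K\<^esub> \<noteq> \<zero>\<^bsub>K\<^esub>"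
    and rota_baxter: "hom_coassociative_rota_baxter_coalgebra K C \<Delta> \<alpha> R weight"
  shows "hom_tridendriform_coalgebra K C
    (tensor_map K C C id C C R \<circ> \<Delta>)
    (\<lambda>x. weight \<odot>\<^bsub>tensor_space K C C\<^esub> \<Delta> x)
    (tensor_map K C C R C C id \<circ> \<Delta>)
    \<alpha>"
proof -
  interpret hom_coassociative_rota_baxter_coalgebra K C \<Delta> \<alpha> R weight by fact
  show ?thesis
    using hom_tridendriform unfolding comult_minus_def comult_zero_def comult_plus_def .
qed

end
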